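(* Let $\mathcal{B}$ be an admissible Banach space of analytic functions on $\mathbb{D}$ (defined in the context). A closed, finite-codimensional subspace $\mathcal{N}$ of $\mathcal{B}$ is $M_z$-invariant if and only if there is a finite zero-specification set $Z$ for $\mathcal{B}$ such that $\mathcal{N}=S_Z$. Moreover: (i) if $\mathcal{B}$ has boundary-extension type $0$ and $Z$ is a finite zero-specification set for $\mathcal{B}$, or if $\mathcal{B}$ has positive boundary-extension type and $Z$ is a finite zero-specification set for $\mathcal{B}$ having no specified points in $\partial\mathbb{D}$, then $S_Z=\mathrm{Range}(M_q)$ for some polynomial $q$ whose zeros are specified by $Z$; (ii) if $\mathcal{B}$ has positive boundary-extension type and $Z$ is a finite zero-specification set for $\mathcal{B}$ having at least one specified point in $\partial\mathbb{D}$, then $S_Z=(\mathrm{Range}(M_q))^-$, where $q$ is a polynomial whose zeros are specified by $Z$. In addition, in both situations (i) and (ii), $\deg(q)=\dim(\mathcal{B}/S_Z)$.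
   Context: $\mathbb{D}$ is the open unit disk in $\mathbb{C}$, $\mathbb{D}^-$ its closure, $H(\mathbb{D})$ the holomorphic functions on $\mathbb{D}$; $S^-$ denotes the closure of a set $S$. For a Banach space $B\subset H(\mathbb{D})$ with continuous point evaluations, $\psi\in H(\mathbb{D})$ is a multiplier of $B$ if $\psi g\in B$ for all $g\in B$; then $M_\psi:B\to B$, $M_\psi g=\psi g$ (also written $M_{\psi(z)}$; $M_z$ is multiplication by the identity function). $C^k(\mathbb{D}^-)$ is the space of functions continuously differentiable on $\mathbb{D}^-$ through order $k$; $B\subset C^k(\mathbb{D}^-)$ means that each $f\in B$ extends to a function (also denoted $f$) in $C^k(\mathbb{D}^-)$. Boundary-extension type: let $B\subset H(\mathbb{D})$ be a Banach space with $M_z:B\to B$ bounded and point evaluations at points of $\mathbb{D}$ continuous. For a positive integer $n$, $B$ has boundary-extension type $n$ if $B\subset C^{n-1}(\mathbb{D}^-)$ and, for each $\zeta\in\partial\mathbb{D}$, the closure of the range of $M_{(z-\zeta)^{n+1}}:B\to B$ contains the function $(z-\zeta)^n$. $B$ has boundary-extension type $0$ if, for each $\zeta\in\partial\mathbb{D}$, the closure of the range of $M_{z-\zeta}:B\to B$ contains the constant function $1$. Positive boundary-extension type means type $n$ for some positive integer $n$. An admissible space is a Banach space $\mathcal{B}$ of analytic functions on $\mathbb{D}$ such that: (i) $\mathcal{B}$ contains the polynomials as a dense subspace; (ii) for each $z\in\mathbb{D}$ the functional $E_z:f\mapsto f(z)$ is continuous on $\mathcal{B}$; (iii) $M_z:\mathcal{B}\to\mathcal{B}$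 is bounded and has spectral radius $1$; (iv) if $q$ is a polynomial all of whose zeros lie in $\mathbb{D}$ and $qf\in\mathcal{B}$ for some $f\in H(\mathbb{D})$, then $f\in\mathcal{B}$; (v) if $g$ is a multiplier of $\mathcal{B}$ that is bounded away from $0$ on $\mathbb{D}$, then $1/g$ is a multiplier of $\mathcal{B}$; (vi) for each positive integer $l$, if $q_k(z)=\sum_{j=0}^l a_{j,k}z^j$ are polynomials with $a_{j,k}\to0$ as $k\to\infty$ for each $j\in\{0,\dots,l\}$, then $q_k\to0$ in $\mathcal{B}$; (vii) $\mathcal{B}$ has boundary-extension type $n$ for some nonnegative integer $n$. Finite zero-specification sets. If $\mathcal{B}$ has boundary-extension type $0$, a finite zero-specification set for $\mathcal{B}$ is a (possibly empty) set $Z=\{(w_i,m_i):1\le i\le l\}$ with $w_1,\dots,w_l$ distinct points of $\mathbb{D}$ and $m_i$ positive integers. If $\mathcal{B}$ has boundary-extension type $n\ge1$, it is a (possibly empty) set $Z=\{(w_i,m_i):1\le i\le l\}\cup\{(\zeta_i,\mu_i):1\le i\le d\}$ with $w_i\in\mathbb{D}$ distinct, $\zeta_i\in\partial\mathbb{D}$ distinct, $m_i$ positive integers, and $\mu_i$ positive integers with $\mu_i\le n$. The $w_i$ and $\zeta_i$ are the specified points of $Z$. $S_\emptyset=\mathcal{B}$, and for nonempty $Z$, $S_Z$ is the set of $f\in\mathcal{B}$ such that $f^{(j)}(w_i)=0$ for $1\le i\le l$, $0\le j\le m_i-1$, and (in the case of positive type) $f^{(j)}(\zeta_i)=0$ for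 $1\le i\le d$, $0\le j\le\mu_i-1$. $Z$ specifies the zeros of $f\in\mathcal{B}$ if the zeros of $f$ and their multiplicities are precisely those given by $Z$ (each $w_i$ is a zero of multiplicity $m_i$, each $\zeta_i$ is a zero of multiplicity $\mu_i$, and $f$ has no other zeros). Here, when $\mathcal{B}$ has type $n\ge 1$, $f$ has $\zeta\in\partial\mathbb{D}$ as a zero of multiplicity $n$ if $f^{(k)}(\zeta)=0$ for $0\le k\le n-1$ and either $f^{(n)}(\zeta)\neq0$ or $f^{(n)}(\zeta)$ does not exist; smaller multiplicities have the usual meaning. *)

theory Defs
  imports "HOL-Complex_Analysis.Complex_Analysis"
begin

section \<open>Complex Banach spaces\<close>

class complex_banach = banach +
  fixes scaleC :: "complex \<Rightarrow> 'a \<Rightarrow> 'a"  (infixr \<open>*\<^sub>C\<close> 75)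
  assumes scaleC_add_right: "a *\<^sub>C (x + y) = a *\<^sub>C x + a *\<^sub>C y"
    and scaleC_add_left: "(a + b) *\<^sub>C x = a *\<^sub>C x + b *\<^sub>C x"
    and scaleC_scaleC: "a *\<^sub>C b *\<^sub>C x = (a * b) *\<^sub>C x"
    and scaleC_of_real: "complex_of_real r *\<^sub>C x = r *\<^sub>R x"
    and norm_scaleC: "norm (a *\<^sub>C x) = cmod a * norm x"

global_interpretation complex_vector: vector_space "scaleC :: complex \<Rightarrow> 'a \<Rightarrow> 'a::complex_banach"
proof
  show "1 *\<^sub>C x = x" for x :: 'a
    using scaleC_of_real[of 1 x] by simp
qed (simp_all add: scaleC_add_right scaleC_add_left scaleC_scaleC)

text \<open>The quotient of the whole space by the subspace \<open>N\<close> has dimension \<open>k\<close>: the cosets of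
  the elements of some \<open>k\<close>-element set \<open>E\<close> form a basis of it.\<close>

definition quotient_has_dim :: "'b::complex_banach set \<Rightarrow> nat \<Rightarrow> bool" where
  "quotient_has_dim N k \<longleftrightarrow>
     (\<exists>E. finite E \<and> card E = k \<and>
          (\<forall>c. (\<Sum>e\<in>E. c e *\<^sub>C e) \<in> N \<longrightarrow> (\<forall>e\<in>E. c e = 0)) \<and>
          (\<forall>f. \<exists>c. f - (\<Sum>e\<in>E. c e *\<^sub>C e) \<in> N))"

definition finite_codimensional :: "'b::complex_banach set \<Rightarrow> bool" where
  "finite_codimensional N \<longleftrightarrow> (\<exists>k. quotient_has_dim N k)"

text \<open>For complex-linear \<open>T\<close>, the two-sided inverse \<open>S\<close> below is automatically complex-linear.\<close>

definition spectrum :: "('b::complex_banach \<Rightarrow> 'b) \<Rightarrow> complex set" where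
  "spectrum T = {a. \<not> (\<exists>S. bounded_linear S \<and>
                          (\<forall>x. S (T x - a *\<^sub>C x) = x) \<and>
                          (\<forall>x. T (S x) - a *\<^sub>C S x = x))}"

definition spectral_radius :: "('b::complex_banach \<Rightarrow> 'b) \<Rightarrow> real" where
  "spectral_radius T = (SUP a\<in>spectrum T. cmod a)"


section \<open>Functions on the closed unit disk\<close>

abbreviation disk :: "complex set"  (\<open>\<D>\<close>) where
  "\<D> \<equiv> ball 0 1"

text \<open>The continuous extension of a function on the disk to the closed disk, if there is one.\<close>

definition extend :: "(complex \<Rightarrow> complex) \<Rightarrow> complex \<Rightarrow> complex" where
  "extend f z = (if z \<in> \<D> then f z else Lim (at z within \<D>) f)"

definition disk_deriv :: "(complex \<Rightarrow> complex) \<Rightarrow> complex \<Rightarrow> complex" where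
  "disk_deriv F z = (SOME d. (F has_field_derivative d) (at z within cball 0 1))"

text \<open>Only used for functions that are holomorphic in the open disk, so that differentiability can
  be taken in the complex sense. At boundary points it is relative to the closed disk.\<close>

definition C_disk :: "nat \<Rightarrow> (complex \<Rightarrow> complex) set" where
  "C_disk k = {F. (\<forall>j<k. \<forall>z\<in>cball 0 1.
                      (disk_deriv ^^ j) F field_differentiable (at z within cball 0 1)) \<and>
                  (\<forall>j\<le>k. continuous_on (cball 0 1) ((disk_deriv ^^ j) F))}"

definition ext_deriv :: "nat \<Rightarrow> (complex \<Rightarrow> complex) \<Rightarrow> complex \<Rightarrow> complex" where
  "ext_deriv j f = (disk_deriv ^^ j) (extend f)"

lemma disk_deriv_eq_deriv:
  assumes "w \<in> \<D>"
  shows "disk_deriv F w = deriv F w"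
proof -
  have "at w within cball 0 1 = at w"
    using assms by (intro at_within_interior) (simp add: interior_cball)
  then show ?thesis
    by (simp add: disk_deriv_def deriv_def)
qed

lemma ext_deriv_interior:
  assumes "w \<in> \<D>"
  shows "ext_deriv j f w = (deriv ^^ j) f w"
  using assms
proof (induction j arbitrary: w)
  case (Suc j)
  have "\<forall>\<^sub>F z in nhds w. z \<in> \<D>"
    using Suc.prems by (intro eventually_nhds_in_open) auto
  then have "\<forall>\<^sub>F z in nhds w. ext_deriv j f z = (deriv ^^ j) f z"
    by eventually_elim (rule Suc.IH)
  then have "deriv (ext_deriv j f) w = deriv ((deriv ^^ j) f) w"
    by (rule deriv_cong_ev) simp
  then show ?case
    using disk_deriv_eq_deriv[OF Suc.prems] by (simp add: ext_deriv_def)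
qed (simp add: ext_deriv_def extend_def)

text \<open>A zero of multiplicity \<open>m\<close> (for \<open>m > 0\<close>): the derivatives of order less than \<open>m\<close> vanish,
  and the derivative of order \<open>m\<close> is nonzero or does not exist. The latter can only happen on
  the boundary, for \<open>m\<close> equal to the boundary-extension type.\<close>

definition zero_of_mult :: "(complex \<Rightarrow> complex) \<Rightarrow> complex \<Rightarrow> nat \<Rightarrow> bool" where
  "zero_of_mult f z m \<longleftrightarrow>
     (\<forall>j<m. ext_deriv j f z = 0) \<and>
     \<not> (ext_deriv (m - 1) f has_field_derivative 0) (at z within cball 0 1)"


section \<open>Banach spaces of analytic functions on the disk\<close>

text \<open>The space is a type \<open>'b\<close> together with a linear map \<open>ev\<close> taking each element to the
  function on the disk that it is. Values of \<open>ev f\<close> off the open disk carry no meaning.\<close>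

locale analytic_banach_space =
  fixes ev :: "'b::complex_banach \<Rightarrow> complex \<Rightarrow> complex"
  assumes ev_holomorphic: "ev f holomorphic_on \<D>"
    and ev_add: "z \<in> \<D> \<Longrightarrow> ev (f + g) z = ev f z + ev g z"
    and ev_scaleC: "z \<in> \<D> \<Longrightarrow> ev (c *\<^sub>C f) z = c * ev f z"
    and ev_inject: "(\<And>z. z \<in> \<D> \<Longrightarrow> ev f z = ev g z) \<Longrightarrow> f = g"

definition represents :: "('b \<Rightarrow> complex \<Rightarrow> complex) \<Rightarrow> 'b \<Rightarrow> (complex \<Rightarrow> complex) \<Rightarrow> bool" where
  "represents ev f \<phi> \<longleftrightarrow> (\<forall>z\<in>\<D>. ev f z = \<phi> z)"

definition elem :: "('b \<Rightarrow> complex \<Rightarrow> complex) \<Rightarrow> (complex \<Rightarrow> complex) \<Rightarrow> 'b" where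
  "elem ev \<phi> = (THE f. represents ev f \<phi>)"

definition multiplier :: "('b \<Rightarrow> complex \<Rightarrow> complex) \<Rightarrow> (complex \<Rightarrow> complex) \<Rightarrow> bool" where
  "multiplier ev \<psi> \<longleftrightarrow>
     \<psi> holomorphic_on \<D> \<and> (\<forall>g. \<exists>h. represents ev h (\<lambda>z. \<psi> z * ev g z))"

definition mult_op :: "('b \<Rightarrow> complex \<Rightarrow> complex) \<Rightarrow> (complex \<Rightarrow> complex) \<Rightarrow> 'b \<Rightarrow> 'b" where
  "mult_op ev \<psi> g = elem ev (\<lambda>z. \<psi> z * ev g z)"

text \<open>For \<open>n = 0\<close> the second condition says that the closure of the range of multiplication by
  \<open>z - \<zeta>\<close> contains the constant function 1.\<close>

definition boundary_extension_type ::
  "('b::complex_banach \<Rightarrow> complex \<Rightarrow> complex) \<Rightarrow> nat \<Rightarrow> bool" where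
  "boundary_extension_type ev n \<longleftrightarrow>
     (n > 0 \<longrightarrow> (\<forall>f. \<exists>F\<in>C_disk (n - 1). \<forall>z\<in>\<D>. F z = ev f z)) \<and>
     (\<forall>\<zeta>\<in>sphere 0 1. \<exists>h\<in>closure (range (mult_op ev (\<lambda>z. (z - \<zeta>) ^ (n + 1)))).
        represents ev h (\<lambda>z. (z - \<zeta>) ^ n))"

definition positive_boundary_extension_type ::
  "('b::complex_banach \<Rightarrow> complex \<Rightarrow> complex) \<Rightarrow> bool" where
  "positive_boundary_extension_type ev \<longleftrightarrow> (\<exists>n>0. boundary_extension_type ev n)"

text \<open>The zero polynomial does not satisfy the hypothesis of \<open>division\<close>, since all complex
  numbers are zeros of it.\<close>

locale admissible_space = analytic_banach_space ev
  for ev :: "'b::complex_banach \<Rightarrow> complex \<Rightarrow> complex" +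
  assumes contains_polynomials: "\<exists>f. represents ev f (poly p)"
    and polynomials_dense: "closure {f. \<exists>p. represents ev f (poly p)} = UNIV"
    and evaluation_continuous: "z \<in> \<D> \<Longrightarrow> continuous_on UNIV (\<lambda>f. ev f z)"
    and z_multiplier: "multiplier ev (\<lambda>z. z)"
    and mult_z_bounded: "bounded_linear (mult_op ev (\<lambda>z. z))"
    and mult_z_spectral_radius: "spectral_radius (mult_op ev (\<lambda>z. z)) = 1"
    and division:
      "\<lbrakk>{z. poly q z = 0} \<subseteq> \<D>; \<phi> holomorphic_on \<D>;
        \<exists>h. represents ev h (\<lambda>z. poly q z * \<phi> z)\<rbrakk> \<Longrightarrow> \<exists>f. represents ev f \<phi>"
    and multiplier_inverse:
      "\<lbrakk>multiplier ev g; \<exists>c>0. \<forall>z\<in>\<D>. c \<le> cmod (g z)\<rbrakk> \<Longrightarrow> multiplier ev (\<lambda>z. 1 / g z)"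
    and coefficients_tendsto_0:
      "\<lbrakk>l > 0; \<And>k. degree (qs k) \<le> l; \<And>j. j \<le> l \<Longrightarrow> (\<lambda>k. coeff (qs k) j) \<longlonglongrightarrow> 0\<rbrakk>
        \<Longrightarrow> (\<lambda>k::nat. elem ev (poly (qs k))) \<longlonglongrightarrow> 0"
    and has_boundary_extension_type: "\<exists>n. boundary_extension_type ev n"


section \<open>Zero-specification sets\<close>

definition finite_zero_specification ::
  "('b::complex_banach \<Rightarrow> complex \<Rightarrow> complex) \<Rightarrow> (complex \<times> nat) set \<Rightarrow> bool" where
  "finite_zero_specification ev Z \<longleftrightarrow>
     finite Z \<and> inj_on fst Z \<and> (\<forall>(w, m)\<in>Z. m > 0) \<and>
     (boundary_extension_type ev 0 \<and> (\<forall>(w, m)\<in>Z. w \<in> \<D>) \<or>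
      (\<exists>n>0. boundary_extension_type ev n \<and>
         (\<forall>(w, m)\<in>Z. w \<in> \<D> \<or> w \<in> sphere 0 1 \<and> m \<le> n)))"

definition zero_subspace ::
  "('b \<Rightarrow> complex \<Rightarrow> complex) \<Rightarrow> (complex \<times> nat) set \<Rightarrow> 'b set" where
  "zero_subspace ev Z = {f. \<forall>(w, m)\<in>Z. \<forall>j<m. ext_deriv j (ev f) w = 0}"

definition specifies_zeros ::
  "('b::complex_banach \<Rightarrow> complex \<Rightarrow> complex) \<Rightarrow> (complex \<times> nat) set \<Rightarrow> 'b \<Rightarrow> bool" where
  "specifies_zeros ev Z f \<longleftrightarrow>
     (\<forall>(w, m)\<in>Z. zero_of_mult (ev f) w m) \<and>
     (\<forall>w\<in>\<D>. ev f w = 0 \<longrightarrow> w \<in> fst ` Z) \<and>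
     (positive_boundary_extension_type ev \<longrightarrow>
        (\<forall>\<zeta>\<in>sphere 0 1. extend (ev f) \<zeta> = 0 \<longrightarrow> \<zeta> \<in> fst ` Z))"

text \<open>A polynomial has zeros in the whole plane, so here \<open>Z\<close> must also account for those outside
  the domain of the functions in the space. Otherwise \<open>degree q\<close> would not be determined by \<open>Z\<close>.\<close>

definition specifies_poly_zeros ::
  "('b::complex_banach \<Rightarrow> complex \<Rightarrow> complex) \<Rightarrow> (complex \<times> nat) set \<Rightarrow> complex poly \<Rightarrow> bool" where
  "specifies_poly_zeros ev Z q \<longleftrightarrow>
     specifies_zeros ev Z (elem ev (poly q)) \<and> {z. poly q z = 0} \<subseteq> fst ` Z"

end

theory Submission
  imports Defs "HOL-Computational_Algebra.Fundamental_Theorem_Algebra"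
begin

text \<open>Multiplication by \<open>z - w\<close> raises the order of vanishing at \<open>w\<close> by exactly one, and derivatives
  at boundary points, up to the order that the type provides, are bounded functionals as pointwise
  limits of bounded functionals. Building up \<open>q\<close> one linear factor at a time therefore yields a
  bounded projection onto the elements vanishing to the orders prescribed by \<open>q\<close>, with the
  polynomials of degree less than \<open>deg q\<close> as complement. Its continuity transfers the density of
  polynomials to this subspace, where polynomials are multiples of \<open>q\<close>. Conversely, the
  polynomials in a closed invariant subspace of finite codimension are the multiples of one \<open>q\<close>,
  and minimality of its degree forces all zeros of \<open>q\<close> to be admissible.\<close>

section \<open>Pointwise limits of bounded linear maps\<close>

text \<open>The type \<open>n\<close> enters in two ways, and these match exactly. Smoothness of
  class C^(n-1) provides the derivatives of order less than \<open>n\<close> at boundary points, so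
  boundary zeros of order up to \<open>n\<close> can be prescribed. The closure condition makes (z -
  \<zeta>)^n a limit of multiples of (z - \<zeta>)^(n+1), so closed invariant subspaces cannot
  distinguish the orders \<open>n\<close> and \<open>n + 1\<close>. Boundary zeros are also the
  reason for closures: \<open>division\<close> only covers factors with zeros in the open disk, so
  at the boundary approximation has to replace division. The obstacle is that polynomials
  approximating an element with prescribed zeros need not have these zeros themselves. The
  projection corrects them continuously, and the correction is again a polynomial, of degree less
  than \<open>deg q\<close>; this also yields the codimension and plays the part of division with
  remainder.\<close>

lemma uniformly_bounded_family:
  fixes f :: "nat \<Rightarrow> 'a::banach \<Rightarrow> 'b::real_normed_vector"
  assumes lin: "\<And>k. bounded_linear (f k)"
    and bdd: "\<And>x. \<exists>C. \<forall>k. norm (f k x) \<le> C"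
  obtains C where "\<And>k x. norm (f k x) \<le> C * norm x"
proof -
  \<comment> \<open>Baire category: these closed sets exhaust the space, so one of them contains a
    ball.\<close>
  define A where "A m = {x. \<forall>k. norm (f k x) \<le> real m}" for m
  have "closed (A m)" for m
  proof -
    have "A m = (\<Inter>k. {x. norm (f k x) \<le> real m})"
      by (auto simp: A_def)
    moreover have "closed {x. norm (f k x) \<le> real m}" for k
      by (intro closed_Collect_le continuous_intros linear_continuous_on lin)
    ultimately show ?thesis by auto
  qed
  moreover have "(\<Union>m. A m) = UNIV"
  proof -
    have "\<exists>m. x \<in> A m" for x
      using bdd[of x] by (auto simp: A_def) (meson order_trans real_arch_simple)
    then show ?thesis by auto
  qed
  moreover have "(\<Union>m. A m) = \<Union>(range A)" by simp
  ultimately have "\<exists>m. interior (A m) \<noteq> {}"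
    using Baire_category_alt[of "euclidean :: 'a topology" "range A"]
    by (auto simp: completely_metrizable_space_euclidean)
  then obtain m x0 r where "r > 0" and ball: "cball x0 r \<subseteq> A m"
    by (auto simp: mem_interior_cball)
  \<comment> \<open>A vector \<open>y\<close> of norm \<open>r\<close> is the difference of the
    points \<open>x0 + y\<close> and \<open>x0\<close> of the ball, on which \<open>f k\<close> is
    bounded by \<open>m\<close>; hence \<open>2 * m\<close>, and scaling gives the constant.\<close>
  have "norm (f k x) \<le> 2 * real m / r * norm x" for k x
  proof (cases "x = 0")
    case False
    define y where "y = (r / norm x) *\<^sub>R x"
    interpret bounded_linear "f k" by (rule lin)
    have "norm y = r" using False \<open>r > 0\<close> by (simp add: y_def)
    then have "x0 + y \<in> A m" "x0 \<in> A m"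
      using ball \<open>r > 0\<close> by (auto simp: dist_norm subset_iff)
    then have "norm (f k (x0 + y)) \<le> m" "norm (f k x0) \<le> m"
      by (auto simp: A_def)
    then have "norm (f k y) \<le> 2 * m"
      using norm_triangle_ineq4[of "f k (x0 + y)" "f k x0"] by (simp add: add)
    then show ?thesis
      using False \<open>r > 0\<close> by (simp add: y_def scaleR field_simps)
  qed (simp add: linear_simps[OF lin])
  then show ?thesis using that by blast
qed

text \<open>Convergent sequences are bounded, so the uniform boundedness principle yields one
  constant for all \<open>f k\<close>, and this constant survives the limit.\<close>

lemma bounded_linear_pointwise_limit:
  fixes f :: "nat \<Rightarrow> 'a::banach \<Rightarrow> 'b::real_normed_vector"
  assumes lin: "\<And>k. bounded_linear (f k)"
    and lim: "\<And>x. (\<lambda>k. f k x) \<longlonglongrightarrow> g x"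
  shows "bounded_linear g"
proof -
  have "\<exists>C. \<forall>k. norm (f k x) \<le> C" for x
    using convergent_imp_Bseq[OF convergentI[OF lim[of x]]] by (auto simp: Bseq_def)
  then obtain C where C: "\<And>k x. norm (f k x) \<le> C * norm x"
    using uniformly_bounded_family[of f, OF lin] by metis
  show ?thesis
  proof (rule bounded_linear_intro)
    show "g (x + y) = g x + g y" for x y
      using lim[of "x + y"] tendsto_add[OF lim[of x] lim[of y]]
      by (intro LIMSEQ_unique) (auto simp: linear_simps[OF lin])
    show "g (r *\<^sub>R x) = r *\<^sub>R g x" for r x
      using lim[of "r *\<^sub>R x"] tendsto_scaleR[OF tendsto_const lim[of x], of r]
      by (intro LIMSEQ_unique) (auto simp: linear_simps[OF lin])
    show "norm (g x) \<le> norm x * C" for x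
      using C by (intro LIMSEQ_le_const2[OF tendsto_norm[OF lim[of x]]]) (auto simp: mult.commute)
  qed
qed

section \<open>Iterated derivatives relative to the closed disk\<close>

lemma at_within_cball_neq_bot:
  fixes z :: complex
  assumes "z \<in> cball 0 1"
  shows "at z within cball 0 1 \<noteq> bot"
  using assms islimpt_ball[of z 0 1] islimpt_subset[of z "ball 0 1" "cball 0 1"]
  by (auto simp: trivial_limit_within)

lemma at_within_disk_neq_bot:
  fixes z :: complex
  assumes "z \<in> cball 0 1"
  shows "at z within \<D> \<noteq> bot"
  using assms islimpt_ball[of z 0 1] by (auto simp: trivial_limit_within)

lemma disk_deriv_eqI:
  assumes "(F has_field_derivative d) (at z within cball 0 1)" "z \<in> cball 0 1"
  shows "disk_deriv F z = d"
  unfolding disk_deriv_def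
  using assms has_field_derivative_unique[OF _ _ at_within_cball_neq_bot] by blast

text \<open>Derivatives are taken relative to the closed disk even if \<open>S\<close> is smaller.
  For relatively open \<open>S\<close> this makes no difference, and one set of rules then serves
  both the open disk, with all orders, and the closed disk, with orders bounded by the type.\<close>

definition smooth_upto :: "nat \<Rightarrow> complex set \<Rightarrow> (complex \<Rightarrow> complex) \<Rightarrow> bool" where
  "smooth_upto k S F \<longleftrightarrow>
     (\<forall>j<k. \<forall>z\<in>S. (disk_deriv ^^ j) F field_differentiable (at z within cball 0 1))"

context
  fixes S :: "complex set"
  assumes S: "openin (top_of_set (cball 0 1)) S"
begin

lemma has_field_derivative_cong_openin:
  assumes "z \<in> S" "\<And>z. z \<in> S \<Longrightarrow> F z = G z"
  shows "(F has_field_derivative d) (at z within cball 0 1) \<longleftrightarrow>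
         (G has_field_derivative d) (at z within cball 0 1)"
proof (rule has_field_derivative_cong_eventually)
  obtain U where "open U" "S = cball 0 1 \<inter> U"
    using S by (auto simp: openin_open)
  then show "\<forall>\<^sub>F z in at z within cball 0 1. F z = G z"
    using assms by (auto simp: eventually_at_topological)
qed (use assms in auto)

text \<open>\<open>disk_deriv\<close> chooses from the set of all possible derivatives, and
  functions that agree near a point have the same such set. The equality therefore holds even where
  no derivative exists.\<close>

lemma disk_deriv_funpow_cong:
  assumes "\<And>z. z \<in> S \<Longrightarrow> F z = G z" "z \<in> S"
  shows "(disk_deriv ^^ j) F z = (disk_deriv ^^ j) G z"
  using assms(2)
proof (induction j arbitrary: z)
  case (Suc j)
  then show ?case
    using has_field_derivative_cong_openin[OF Suc.prems, of "(disk_deriv ^^ j) F" "(disk_deriv ^^ j) G"]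
    by (simp add: disk_deriv_def[of "(disk_deriv ^^ j) F"] disk_deriv_def[of "(disk_deriv ^^ j) G"])
qed (simp add: assms)

lemma smooth_upto_cong:
  assumes "\<And>z. z \<in> S \<Longrightarrow> F z = G z" "smooth_upto k S F"
  shows "smooth_upto k S G"
  unfolding smooth_upto_def
proof (intro allI impI ballI)
  fix j z assume "j < k" "z \<in> S"
  then have "(disk_deriv ^^ j) F field_differentiable (at z within cball 0 1)"
    using assms(2) by (auto simp: smooth_upto_def)
  then show "(disk_deriv ^^ j) G field_differentiable (at z within cball 0 1)"
    using has_field_derivative_cong_openin[OF \<open>z \<in> S\<close>,
        of "(disk_deriv ^^ j) F" "(disk_deriv ^^ j) G"] disk_deriv_funpow_cong[of F G _ j, OF assms(1)]
    by (simp add: field_differentiable_def)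
qed

lemma disk_deriv_funpow_Suc:
  assumes "smooth_upto (Suc j) S F" "z \<in> S"
  shows "((disk_deriv ^^ j) F has_field_derivative (disk_deriv ^^ Suc j) F z) (at z within cball 0 1)"
  using assms someI_ex[of "\<lambda>d. ((disk_deriv ^^ j) F has_field_derivative d) (at z within cball 0 1)"]
  by (auto simp: smooth_upto_def field_differentiable_def disk_deriv_def)

text \<open>The induction step of the derivative rules below: a formula for the \<open>j\<close>-th
  derivative that is valid on all of \<open>S\<close> may be differentiated once more at
  \<open>z\<close>.\<close>

lemma disk_deriv_funpow_eqI:
  assumes "z \<in> S" "\<And>z. z \<in> S \<Longrightarrow> (disk_deriv ^^ j) F z = G z"
    "(G has_field_derivative d) (at z within cball 0 1)"
  shows "(disk_deriv ^^ Suc j) F z = d"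
proof -
  have "((disk_deriv ^^ j) F has_field_derivative d) (at z within cball 0 1)"
    using has_field_derivative_cong_openin[OF assms(1,2)] assms(3) by simp
  moreover have "z \<in> cball 0 1"
    using S assms(1) openin_imp_subset by blast
  ultimately show ?thesis
    by (simp add: disk_deriv_eqI)
qed

lemma smooth_upto_Suc: "smooth_upto (Suc j) S F \<Longrightarrow> smooth_upto j S F"
  by (auto simp: smooth_upto_def)

lemma disk_deriv_funpow_add:
  assumes "smooth_upto j S F" "smooth_upto j S G" "z \<in> S"
  shows "(disk_deriv ^^ j) (\<lambda>z. F z + G z) z = (disk_deriv ^^ j) F z + (disk_deriv ^^ j) G z"
  using assms
proof (induction j arbitrary: z)
  case (Suc j)
  show ?case
    by (rule disk_deriv_funpow_eqI[OF Suc.prems(3) Suc.IH])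
      (use Suc.prems smooth_upto_Suc in \<open>auto intro!: DERIV_add disk_deriv_funpow_Suc simp del: funpow.simps\<close>)
qed simp

lemma disk_deriv_funpow_cmult:
  assumes "smooth_upto j S F" "z \<in> S"
  shows "(disk_deriv ^^ j) (\<lambda>z. c * F z) z = c * (disk_deriv ^^ j) F z"
  using assms
proof (induction j arbitrary: z)
  case (Suc j)
  show ?case
    by (rule disk_deriv_funpow_eqI[OF Suc.prems(2) Suc.IH])
      (use Suc.prems smooth_upto_Suc in \<open>auto intro!: DERIV_cmult disk_deriv_funpow_Suc simp del: funpow.simps\<close>)
qed simp

text \<open>The Leibniz rule has only two terms here since the second derivative of the identity
  vanishes. For \<open>j = 0\<close> the truncated \<open>j - 1\<close> is harmless because its term
  has the factor 0.\<close>

lemma disk_deriv_funpow_times_id: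
  assumes "smooth_upto j S F" "z \<in> S"
  shows "(disk_deriv ^^ j) (\<lambda>z. z * F z) z =
    z * (disk_deriv ^^ j) F z + of_nat j * (disk_deriv ^^ (j - 1)) F z"
  using assms
proof (induction j arbitrary: z)
  case (Suc j)
  note sm = Suc.prems(1) smooth_upto_Suc[OF Suc.prems(1)]
  have 1: "((\<lambda>z. z * (disk_deriv ^^ j) F z) has_field_derivative
      (disk_deriv ^^ j) F z + z * (disk_deriv ^^ Suc j) F z) (at z within cball 0 1)"
    using DERIV_mult[OF DERIV_ident disk_deriv_funpow_Suc[OF sm(1) Suc.prems(2)]]
    by (simp add: mult.commute)
  have 2: "((\<lambda>z. of_nat j * (disk_deriv ^^ (j - 1)) F z) has_field_derivative
      of_nat j * (disk_deriv ^^ j) F z) (at z within cball 0 1)"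
  proof (cases j)
    case (Suc i)
    then show ?thesis
      using DERIV_cmult[OF disk_deriv_funpow_Suc[OF _ Suc.prems(2), of i F], of "of_nat j"] sm by simp
  qed simp
  have "(disk_deriv ^^ Suc j) (\<lambda>z. z * F z) z =
      (disk_deriv ^^ j) F z + z * (disk_deriv ^^ Suc j) F z + of_nat j * (disk_deriv ^^ j) F z"
    by (rule disk_deriv_funpow_eqI[OF Suc.prems(2) Suc.IH DERIV_add[OF 1 2]]) (use sm in auto)
  then show ?case by (simp add: algebra_simps)
qed simp

end

lemma disk_deriv_funpow_poly:
  assumes "z \<in> cball 0 1"
  shows "(disk_deriv ^^ j) (poly p) z = poly ((pderiv ^^ j) p) z"
  using assms
proof (induction j arbitrary: z)
  case (Suc j)
  show ?case
    by (rule disk_deriv_funpow_eqI[OF openin_subtopology_self Suc.prems Suc.IH])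
      (auto intro: has_field_derivative_at_within)
qed simp

section \<open>Complex polynomials and their zeros\<close>

text \<open>For \<open>n = 0\<close> the second alternative fails at every zero of \<open>q\<close>,
  the order there being positive; all zeros then lie in the open disk.\<close>

definition zeros_specifiable :: "nat \<Rightarrow> complex poly \<Rightarrow> bool" where
  "zeros_specifiable n q \<longleftrightarrow>
     q \<noteq> 0 \<and> (\<forall>w. poly q w = 0 \<longrightarrow> w \<in> \<D> \<or> w \<in> sphere 0 1 \<and> order w q \<le> n)"

lemma linear_mult_neq_0: "q \<noteq> 0 \<Longrightarrow> [:- w, 1:] * q \<noteq> (0 :: complex poly)"
  by (metis mult_eq_0_iff pCons_eq_0_iff one_neq_zero)

lemma order_linear_mult:
  fixes q :: "complex poly"
  assumes "q \<noteq> 0"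
  shows "order u ([:- w, 1:] * q) = (if u = w then Suc (order u q) else order u q)"
proof -
  have ne: "[:- w, 1:] * q \<noteq> 0" using assms by (rule linear_mult_neq_0)
  have "order u [:- w, 1:] = (if u = w then 1 else 0)"
    using order_power_n_n[of w 1] by (auto intro: order_0I)
  then show ?thesis unfolding order_mult[OF ne] by simp
qed

lemma zeros_specifiable_mult:
  assumes "zeros_specifiable n (p * q)"
  shows "zeros_specifiable n q"
  using assms by (fastforce simp: zeros_specifiable_def order_mult)

lemma complex_poly_factor_induct [consumes 1, case_names const linear]:
  fixes q :: "complex poly"
  assumes "q \<noteq> 0" "\<And>c. c \<noteq> 0 \<Longrightarrow> P [:c:]" "\<And>w q. q \<noteq> 0 \<Longrightarrow> P q \<Longrightarrow> P ([:- w, 1:] * q)"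
  shows "P q"
  using assms(1)
proof (induction "degree q" arbitrary: q)
  case 0
  then show ?case
    using assms(2) by (metis degree_eq_zeroE pCons_0_0)
next
  case (Suc d)
  then obtain w where "poly q w = 0"
    using alg_closed_imp_poly_has_root[of q] by auto
  then obtain r where r: "q = [:- w, 1:] * r"
    by (auto simp: poly_eq_0_iff_dvd elim: dvdE)
  with Suc.prems have "r \<noteq> 0" by auto
  moreover have "degree q = Suc (degree r)"
    unfolding r using \<open>r \<noteq> 0\<close> by (subst degree_mult_eq) auto
  ultimately show ?case
    using Suc assms(3) r by simp
qed

text \<open>Differentiation lowers the order of a root by exactly one, which drives the induction on
  \<open>m\<close>.\<close>

lemma pderiv_funpow_zero_iff_order:
  fixes q :: "complex poly"
  assumes "q \<noteq> 0"
  shows "(\<forall>j<m. poly ((pderiv ^^ j) q) w = 0) \<longleftrightarrow> m \<le> order w q"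
  using assms
proof (induction m arbitrary: q)
  case (Suc m)
  have "(\<forall>j<Suc m. poly ((pderiv ^^ j) q) w = 0) \<longleftrightarrow>
      poly q w = 0 \<and> (\<forall>j<m. poly ((pderiv ^^ j) (pderiv q)) w = 0)"
    by (simp add: All_less_Suc2 funpow_Suc_right del: funpow.simps(2))
  also have "\<dots> \<longleftrightarrow> Suc m \<le> order w q"
  proof (cases "poly q w = 0")
    case True
    have "pderiv q \<noteq> 0"
    proof
      assume "pderiv q = 0"
      then obtain c where "q = [:c:]"
        by (metis degree_eq_zeroE pderiv_eq_0_iff)
      then show False using True Suc.prems by simp
    qed
    then show ?thesis
      using True Suc order_pderiv[OF Suc.prems True] by simp
  next
    case False
    then show ?thesis by (simp add: order_0I)
  qed
  finally show ?case .
qed simp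

text \<open>The purely algebraic counterpart of \<open>specifies_poly_zeros\<close>;
  \<open>specifies_poly_zeros_iff\<close> shows that they agree for every finite zero-specification
  set.\<close>

definition prescribes_zeros :: "(complex \<times> nat) set \<Rightarrow> complex poly \<Rightarrow> bool" where
  "prescribes_zeros Z q \<longleftrightarrow>
     q \<noteq> 0 \<and> {z. poly q z = 0} \<subseteq> fst ` Z \<and> (\<forall>(w, m)\<in>Z. order w q = m)"

lemma prescribed_poly_exists:
  assumes "finite Z" "inj_on fst Z" "\<forall>(w, m)\<in>Z. m > 0"
  shows "\<exists>q. prescribes_zeros Z q"
  using assms
proof (induction Z rule: finite_induct)
  case empty
  have "prescribes_zeros {} 1" by (simp add: prescribes_zeros_def)
  then show ?case by blast
next
  case (insert a Z)
  obtain w m where a: "a = (w, m)" by (cases a)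
  obtain q where q: "prescribes_zeros Z q"
    using insert by auto
  have "w \<notin> fst ` Z"
    using insert by (auto simp: a)
  have ne: "[:- w, 1:] ^ m * q \<noteq> 0"
    using q by (auto simp: prescribes_zeros_def)
  have ord: "order u ([:- w, 1:] ^ m * q) = (if u = w then m else order u q)" for u
  proof -
    have "poly q w \<noteq> 0"
      using q \<open>w \<notin> fst ` Z\<close> by (auto simp: prescribes_zeros_def)
    moreover have "order u ([:- w, 1:] ^ m) = (if u = w then m else 0)"
      using order_power_n_n[of w m] by (auto intro!: order_0I simp: poly_power)
    ultimately show ?thesis
      unfolding order_mult[OF ne] by (simp add: order_0I)
  qed
  have "prescribes_zeros (insert a Z) ([:- w, 1:] ^ m * q)"
    unfolding prescribes_zeros_def
  proof (intro conjI ne)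
    show "{z. poly ([:- w, 1:] ^ m * q) z = 0} \<subseteq> fst ` insert a Z"
      using q by (auto simp: prescribes_zeros_def a poly_power)
    show "\<forall>(u, k)\<in>insert a Z. order u ([:- w, 1:] ^ m * q) = k"
      unfolding ord using q \<open>w \<notin> fst ` Z\<close> by (force simp: prescribes_zeros_def a)
  qed
  then show ?case by blast
qed

section \<open>Multiplication by polynomials\<close>

lemma bounded_linear_scaleC: "bounded_linear (\<lambda>f::'b::complex_banach. a *\<^sub>C f)"
proof (rule bounded_linear_intro[where K = "cmod a"])
  show "a *\<^sub>C r *\<^sub>R f = r *\<^sub>R a *\<^sub>C f" for r and f :: 'b
    unfolding scaleC_of_real[symmetric] scaleC_scaleC by (simp add: mult.commute)
qed (simp_all add: scaleC_add_right norm_scaleC mult.commute)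

lemma bounded_linear_if_continuous:
  fixes f :: "'a::real_normed_vector \<Rightarrow> 'b::real_normed_vector"
  assumes "linear f" "continuous_on UNIV f"
  shows "bounded_linear f"
proof -
  interpret linear f by fact
  obtain d where "d > 0" and d: "\<And>x. norm x < d \<Longrightarrow> norm (f x) < 1"
    using assms(2)[unfolded continuous_on_iff, rule_format, of 0 1]
    by (auto simp: dist_norm zero)
  have "norm (f x) \<le> norm x * (2 / d)" for x
  proof (cases "x = 0")
    case False
    \<comment> \<open>Rescaling \<open>x\<close> to norm \<open>d / 2\<close> brings it into the
      ball on which \<open>f\<close> is bounded by 1, hence the constant
      \<open>2 / d\<close>.\<close>
    have "norm ((d / (2 * norm x)) *\<^sub>R x) < d"
      using False \<open>d > 0\<close> by simp
    then have "norm (f ((d / (2 * norm x)) *\<^sub>R x)) < 1" by (rule d)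
    then show ?thesis
      using False \<open>d > 0\<close> by (simp add: scale field_simps)
  qed (simp add: zero)
  then show ?thesis
    by (intro bounded_linear_intro[where K = "2 / d"]) (auto simp: add scale)
qed

context admissible_space
begin

abbreviation poly_elem :: "complex poly \<Rightarrow> 'b" where
  "poly_elem p \<equiv> elem ev (poly p)"

abbreviation mult_z :: "'b \<Rightarrow> 'b" where
  "mult_z \<equiv> mult_op ev (\<lambda>z. z)"

abbreviation mult_poly :: "complex poly \<Rightarrow> 'b \<Rightarrow> 'b" where
  "mult_poly p \<equiv> mult_op ev (poly p)"

lemma elem_eqI: "represents ev f \<phi> \<Longrightarrow> elem ev \<phi> = f"
  unfolding elem_def
proof (rule the_equality)
  fix g assume "represents ev f \<phi>" "represents ev g \<phi>"
  then show "g = f" by (intro ev_inject) (auto simp: represents_def)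
qed

lemma ev_elem: "\<exists>f. represents ev f \<phi> \<Longrightarrow> z \<in> \<D> \<Longrightarrow> ev (elem ev \<phi>) z = \<phi> z"
  using elem_eqI by (auto simp: represents_def)

lemma ev_poly_elem [simp]: "z \<in> \<D> \<Longrightarrow> ev (poly_elem p) z = poly p z"
  by (rule ev_elem[OF contains_polynomials])

lemma ev_mult_z: "z \<in> \<D> \<Longrightarrow> ev (mult_z f) z = z * ev f z"
  using z_multiplier ev_elem[of "\<lambda>z. z * ev f z"] by (auto simp: multiplier_def mult_op_def)

text \<open>\<open>mult_op\<close> is a definite description, so its values are known only once some
  element represents the product. Horner's scheme builds such an element from
  \<open>mult_z\<close>.\<close>

lemma ev_mult_poly: "z \<in> \<D> \<Longrightarrow> ev (mult_poly p f) z = poly p z * ev f z"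
proof -
  have "\<exists>h. represents ev h (\<lambda>z. poly p z * ev f z)"
  proof (induction p)
    case 0
    have "represents ev (0 *\<^sub>C f) (\<lambda>z. poly 0 z * ev f z)"
      by (auto simp: represents_def ev_scaleC simp del: complex_vector.scale_zero_left)
    then show ?case by blast
  next
    case (pCons a p)
    then obtain h where "represents ev h (\<lambda>z. poly p z * ev f z)" by blast
    then have "represents ev (a *\<^sub>C f + mult_z h) (\<lambda>z. poly (pCons a p) z * ev f z)"
      by (auto simp: represents_def ev_add ev_scaleC ev_mult_z algebra_simps)
    then show ?case by blast
  qed
  then show "z \<in> \<D> \<Longrightarrow> ev (mult_poly p f) z = poly p z * ev f z"
    unfolding mult_op_def by (rule ev_elem)
qed

lemma ev_0: "z \<in> \<D> \<Longrightarrow> ev 0 z = 0"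
  using ev_scaleC[of z 0 0] by simp

lemma ev_diff: "z \<in> \<D> \<Longrightarrow> ev (f - g) z = ev f z - ev g z"
  using ev_add[of z "f - g" g] by simp

lemma ev_sum: "z \<in> \<D> \<Longrightarrow> ev (\<Sum>i\<in>A. F i) z = (\<Sum>i\<in>A. ev (F i) z)"
  by (induction A rule: infinite_finite_induct) (simp_all add: ev_0 ev_add)

lemmas ev_simps = ev_add ev_scaleC ev_mult_z ev_mult_poly ev_0 ev_diff ev_sum

lemma poly_elem_add: "poly_elem (p + q) = poly_elem p + poly_elem q"
  and poly_elem_diff: "poly_elem (p - q) = poly_elem p - poly_elem q"
  and poly_elem_smult: "poly_elem (smult c p) = c *\<^sub>C poly_elem p"
  and poly_elem_0: "poly_elem 0 = 0"
  and poly_elem_sum: "poly_elem (\<Sum>i\<in>A. F i) = (\<Sum>i\<in>A. poly_elem (F i))"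
  and mult_poly_poly_elem: "mult_poly p (poly_elem q) = poly_elem (p * q)"
  and mult_poly_mult: "mult_poly (p * q) f = mult_poly p (mult_poly q f)"
  and mult_poly_0: "mult_poly 0 f = 0"
  and mult_poly_pCons: "mult_poly (pCons a p) f = a *\<^sub>C f + mult_z (mult_poly p f)"
  by (rule ev_inject; simp add: ev_simps algebra_simps poly_sum)+

lemma mult_poly_linear: "mult_poly [:- w, 1:] f = mult_z f - w *\<^sub>C f"
  by (rule ev_inject) (simp add: ev_simps algebra_simps)

lemma poly_elem_inject: "poly_elem p = poly_elem q \<longleftrightarrow> p = q"
proof
  assume eq: "poly_elem p = poly_elem q"
  have "poly (p - q) z = 0" if "z \<in> \<D>" for z
    using ev_poly_elem[OF that, of p] ev_poly_elem[OF that, of q] eq by simp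
  moreover have "infinite \<D>"
    using uncountable_ball[of 1 "0::complex"] by (auto dest: countable_finite)
  ultimately have "infinite {z. poly (p - q) z = 0}"
    using infinite_super[of \<D> "{z. poly (p - q) z = 0}"] by blast
  then show "p = q"
    using poly_roots_finite[of "p - q"] by auto
qed simp

lemma bounded_linear_mult_poly: "bounded_linear (mult_poly p)"
proof (induction p)
  case 0
  have "mult_poly 0 = (\<lambda>f. 0)" by (rule ext) (rule mult_poly_0)
  then show ?case by (simp only: bounded_linear_zero)
next
  case (pCons a p)
  then show ?case
    unfolding mult_poly_pCons [abs_def]
    by (intro bounded_linear_add bounded_linear_scaleC bounded_linear_compose[OF mult_z_bounded])
qed

lemma poly_elem_approx:
  obtains p where "(\<lambda>k. poly_elem (p k)) \<longlonglongrightarrow> f"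
proof -
  have "f \<in> closure {f. \<exists>p. represents ev f (poly p)}"
    using polynomials_dense by simp
  then obtain g where g: "\<And>k. \<exists>p. represents ev (g k) (poly p)" "g \<longlonglongrightarrow> f"
    unfolding closure_sequential by auto
  then obtain p where "\<And>k. represents ev (g k) (poly (p k))" by metis
  then have "(\<lambda>k. poly_elem (p k)) = g"
    by (auto simp: elem_eqI)
  with g that show ?thesis by metis
qed

section \<open>Boundary values as bounded functionals\<close>

text \<open>Uniform in \<open>f\<close>, so that derivatives at a point of \<open>S\<close> become
  functionals on the whole space. The limit clause ensures that \<open>extend\<close> takes genuine
  boundary values and not arbitrary values of \<open>Lim\<close>.\<close>

definition smooth_on :: "nat \<Rightarrow> complex set \<Rightarrow> bool" where
  "smooth_on k S \<longleftrightarrow> openin (top_of_set (cball 0 1)) S \<and>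
     (\<forall>f. smooth_upto k S (extend (ev f)) \<and> (\<forall>z\<in>S. (ev f \<longlongrightarrow> extend (ev f) z) (at z within \<D>)))"

lemma smooth_on_Suc: "smooth_on (Suc k) S \<Longrightarrow> smooth_on k S"
  using smooth_upto_Suc by (auto simp: smooth_on_def)

lemma smooth_on_subset: "smooth_on k S \<Longrightarrow> S \<subseteq> cball 0 1"
  using openin_imp_subset by (auto simp: smooth_on_def)

lemma smooth_on_disk: "smooth_on k \<D>"
  unfolding smooth_on_def
proof (intro conjI allI ballI)
  show op: "openin (top_of_set (cball 0 1)) \<D>"
    by (auto simp: openin_open intro!: exI[of _ \<D>])
  fix f
  show "smooth_upto k \<D> (extend (ev f))"
    unfolding smooth_upto_def
  proof (intro allI impI ballI)
    fix j and z :: complex assume "z \<in> \<D>"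
    have "(deriv ^^ j) (ev f) field_differentiable (at z within cball 0 1)"
      by (rule field_differentiable_at_within[OF holomorphic_on_imp_differentiable_at[OF
            holomorphic_higher_deriv[OF ev_holomorphic open_ball] open_ball \<open>z \<in> \<D>\<close>]])
    then show "(disk_deriv ^^ j) (extend (ev f)) field_differentiable (at z within cball 0 1)"
      using has_field_derivative_cong_openin[OF op \<open>z \<in> \<D>\<close>,
          of "ext_deriv j (ev f)" "(deriv ^^ j) (ev f)"] ext_deriv_interior[of _ j "ev f"]
      by (simp add: field_differentiable_def ext_deriv_def del: mem_ball_0)
  qed
  fix z :: complex assume "z \<in> \<D>"
  have "(ev f \<longlongrightarrow> ev f z) (at z within \<D>)"
    using holomorphic_on_imp_continuous_on[OF ev_holomorphic, of f] \<open>z \<in> \<D>\<close>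
    unfolding continuous_on_def by blast
  then show "(ev f \<longlongrightarrow> extend (ev f) z) (at z within \<D>)"
    using \<open>z \<in> \<D>\<close> by (simp add: extend_def)
qed

lemma extend_eqI:
  assumes "(\<phi> \<longlongrightarrow> \<phi> z) (at z within \<D>)" "z \<in> cball 0 1" "\<And>w. w \<in> \<D> \<Longrightarrow> F w = \<phi> w"
  shows "extend F z = \<phi> z" and "(F \<longlongrightarrow> \<phi> z) (at z within \<D>)"
proof -
  show lim: "(F \<longlongrightarrow> \<phi> z) (at z within \<D>)"
    using assms(1) by (rule Lim_transform_eventually) (auto simp: assms(3) eventually_at_filter)
  show "extend F z = \<phi> z"
    using tendsto_Lim[OF at_within_disk_neq_bot[OF assms(2)] lim] assms(3)
    by (auto simp: extend_def)
qed

text \<open>The type only provides some extension \<open>F\<close>. Its continuity makes it the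
  limit from inside the disk, so it coincides with \<open>extend\<close> on the closed disk.\<close>

lemma smooth_on_cball:
  assumes "boundary_extension_type ev n" "n > 0"
  shows "smooth_on (n - 1) (cball 0 1)"
  unfolding smooth_on_def
proof (intro conjI allI ballI)
  fix f
  obtain F where F: "F \<in> C_disk (n - 1)" "\<And>z. z \<in> \<D> \<Longrightarrow> ev f z = F z"
    using assms unfolding boundary_extension_type_def by metis
  have lim: "(F \<longlongrightarrow> F z) (at z within \<D>)" if "z \<in> cball 0 1" for z
  proof -
    have "continuous_on (cball 0 1) F"
      using F(1) by (force simp: C_disk_def)
    then have "(F \<longlongrightarrow> F z) (at z within cball 0 1)"
      using that by (simp add: continuous_on_def)
    then show ?thesis
      by (rule tendsto_within_subset) (rule ball_subset_cball)
  qed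
  have eq: "extend (ev f) z = F z" "(ev f \<longlongrightarrow> F z) (at z within \<D>)" if "z \<in> cball 0 1" for z
    using extend_eqI[of F z "ev f", OF lim[OF that] that F(2)] by blast+
  have "smooth_upto (n - 1) (cball 0 1) F"
    using F(1) by (simp add: C_disk_def smooth_upto_def)
  then show "smooth_upto (n - 1) (cball 0 1) (extend (ev f))"
    by (rule smooth_upto_cong[OF openin_subtopology_self, rotated]) (rule eq(1)[symmetric])
  show "(ev f \<longlongrightarrow> extend (ev f) z) (at z within \<D>)" if "z \<in> cball 0 1" for z
    using eq that by simp
qed auto

lemma extend_ev_eqI:
  assumes "z \<in> cball 0 1" "\<And>w. w \<in> \<D> \<Longrightarrow> ev f w = \<phi> w" "(\<phi> \<longlongrightarrow> L) (at z within \<D>)"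
    "smooth_on k S" "z \<in> S"
  shows "extend (ev f) z = L"
proof (rule tendsto_unique[OF at_within_disk_neq_bot[OF assms(1)]])
  show "(ev f \<longlongrightarrow> extend (ev f) z) (at z within \<D>)"
    using assms by (auto simp: smooth_on_def)
  show "(ev f \<longlongrightarrow> L) (at z within \<D>)"
    using assms(3) by (rule Lim_transform_eventually) (auto simp: assms(2) eventually_at_filter)
qed

context
  fixes j S z
  assumes sm: "smooth_on j S" and z: "z \<in> S"
begin

private lemma extend_combinations:
  assumes "w \<in> S"
  shows "extend (ev (f + g)) w = extend (ev f) w + extend (ev g) w"
    and "extend (ev (c *\<^sub>C f)) w = c * extend (ev f) w"
    and "extend (ev (mult_z f)) w = w * extend (ev f) w"
proof -
  have lim: "(ev f \<longlongrightarrow> extend (ev f) w) (at w within \<D>)" for f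
    using sm assms by (auto simp: smooth_on_def)
  have w: "w \<in> cball 0 1"
    using smooth_on_subset[OF sm] assms by blast
  note eqI = extend_ev_eqI[OF w _ _ sm assms]
  show "extend (ev (f + g)) w = extend (ev f) w + extend (ev g) w"
    by (rule eqI[OF ev_add tendsto_add[OF lim lim]])
  show "extend (ev (c *\<^sub>C f)) w = c * extend (ev f) w"
    by (rule eqI[OF ev_scaleC tendsto_mult[OF tendsto_const lim]])
  show "extend (ev (mult_z f)) w = w * extend (ev f) w"
    by (rule eqI[OF ev_mult_z tendsto_mult[OF tendsto_ident_at lim]])
qed

text \<open>Uniqueness of limits carries the operations over to \<open>extend\<close>;
  \<open>smooth_on\<close> then provides the derivatives to which the sum, scalar and Leibniz rules
  apply.\<close>

lemma ext_deriv_add: "ext_deriv j (ev (f + g)) z = ext_deriv j (ev f) z + ext_deriv j (ev g) z"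
  and ext_deriv_scaleC: "ext_deriv j (ev (c *\<^sub>C f)) z = c * ext_deriv j (ev f) z"
  and ext_deriv_mult_z: "ext_deriv j (ev (mult_z f)) z =
    z * ext_deriv j (ev f) z + of_nat j * ext_deriv (j - 1) (ev f) z"
proof -
  have op: "openin (top_of_set (cball 0 1)) S" and sm': "\<And>f. smooth_upto j S (extend (ev f))"
    using sm by (auto simp: smooth_on_def)
  show "ext_deriv j (ev (f + g)) z = ext_deriv j (ev f) z + ext_deriv j (ev g) z"
    unfolding ext_deriv_def disk_deriv_funpow_add[OF op sm' sm' z, symmetric]
    by (rule disk_deriv_funpow_cong[OF op extend_combinations(1) z])
  show "ext_deriv j (ev (c *\<^sub>C f)) z = c * ext_deriv j (ev f) z"
    unfolding ext_deriv_def disk_deriv_funpow_cmult[OF op sm' z, symmetric]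
    by (rule disk_deriv_funpow_cong[OF op extend_combinations(2) z])
  show "ext_deriv j (ev (mult_z f)) z =
      z * ext_deriv j (ev f) z + of_nat j * ext_deriv (j - 1) (ev f) z"
    unfolding ext_deriv_def disk_deriv_funpow_times_id[OF op sm' z, symmetric]
    by (rule disk_deriv_funpow_cong[OF op extend_combinations(3) z])
qed

end

text \<open>This covers every order \<open>j\<close>, also those beyond the smoothness that the type
  guarantees; a boundary zero of multiplicity exactly \<open>n\<close> is tested by the derivative
  of order \<open>n\<close>.\<close>

lemma ext_deriv_poly_elem:
  assumes "z \<in> cball 0 1"
  shows "ext_deriv j (ev (poly_elem p)) z = poly ((pderiv ^^ j) p) z"
proof -
  have "extend (ev (poly_elem p)) w = poly p w" if "w \<in> cball 0 1" for w
    using that by (intro extend_eqI(1)[of "poly p" w]) (auto intro!: tendsto_intros)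
  then show ?thesis
    unfolding ext_deriv_def disk_deriv_funpow_poly[OF assms, symmetric]
    by (rule disk_deriv_funpow_cong[OF openin_subtopology_self _ assms])
qed

lemma bounded_linear_ev: "z \<in> \<D> \<Longrightarrow> bounded_linear (\<lambda>f. ev f z)"
  by (intro bounded_linear_if_continuous evaluation_continuous linearI)
    (simp_all add: ev_add ev_scaleC scaleC_of_real[symmetric] scaleR_conv_of_real)

text \<open>Derivatives and boundary values are pointwise limits of sequences of difference quotients
  and interior values.\<close>

lemma bounded_linear_ext_deriv:
  assumes "smooth_on j S" "z \<in> S"
  shows "bounded_linear (\<lambda>f. ext_deriv j (ev f) z)"
  using assms
proof (induction j arbitrary: z)
  case 0
  then have "z islimpt \<D>"
    using smooth_on_subset[of 0 S] islimpt_ball[of z 0 1] by auto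
  then obtain w where w: "\<And>k. w k \<in> \<D> - {z}" "w \<longlonglongrightarrow> z"
    unfolding islimpt_sequential by blast
  show ?case
  proof (rule bounded_linear_pointwise_limit)
    show "bounded_linear (\<lambda>f. ev f (w k))" for k
      using w by (intro bounded_linear_ev) auto
    have "(ev f \<longlongrightarrow> extend (ev f) z) (at z within \<D>)" for f
      using 0 by (auto simp: smooth_on_def)
    then show "(\<lambda>k. ev f (w k)) \<longlonglongrightarrow> ext_deriv 0 (ev f) z" for f
      using w unfolding tendsto_at_iff_sequentially by (auto simp: ext_deriv_def o_def)
  qed
next
  case (Suc j)
  have op: "openin (top_of_set (cball 0 1)) S" and sm: "\<And>f. smooth_upto (Suc j) S (extend (ev f))"
    using Suc.prems by (auto simp: smooth_on_def)
  obtain U where U: "open U" "S = cball 0 1 \<inter> U"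
    using op by (auto simp: openin_open)
  have within: "at z within S = at z within cball 0 1"
    using U Suc.prems by (intro at_within_nhd[of z U]) auto
  have "z \<in> cball 0 1"
    using U Suc.prems by auto
  then have "z islimpt S"
    using at_within_cball_neq_bot[of z] within trivial_limit_within[of z S] by simp
  \<comment> \<open>The points \<open>w k\<close> have to stay in \<open>S\<close>, where the
    induction hypothesis makes the \<open>j\<close>-th derivatives bounded functionals; for boundary
    points \<open>z\<close> they may lie anywhere near \<open>z\<close> in the closed disk.\<close>
  then obtain w where w: "\<And>k. w k \<in> S - {z}" "w \<longlonglongrightarrow> z"
    unfolding islimpt_sequential by blast
  show ?case
  proof (rule bounded_linear_pointwise_limit)
    show "bounded_linear (\<lambda>f. (ext_deriv j (ev f) (w k) - ext_deriv j (ev f) z) / (w k - z))" for k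
      using w Suc smooth_on_Suc
      by (intro bounded_linear_divide[THEN bounded_linear_compose] bounded_linear_sub Suc.IH) auto
    fix f
    have "(ext_deriv j (ev f) has_field_derivative ext_deriv (Suc j) (ev f) z) (at z within S)"
      unfolding ext_deriv_def within by (rule disk_deriv_funpow_Suc[OF op sm Suc.prems(2)])
    then show "(\<lambda>k. (ext_deriv j (ev f) (w k) - ext_deriv j (ev f) z) / (w k - z))
        \<longlonglongrightarrow> ext_deriv (Suc j) (ev f) z"
      using w unfolding has_field_derivative_iff tendsto_at_iff_sequentially by (auto simp: o_def)
  qed
qed

section \<open>Elements with prescribed zeros\<close>

text \<open>The subspace of a zero-specification set, encoded by a polynomial so that induction over
  linear factors applies. Points that are no zeros of \<open>q\<close> have order 0 and impose no
  condition.\<close>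

definition vanishing_space :: "complex poly \<Rightarrow> 'b set" where
  "vanishing_space q = {f. \<forall>w. \<forall>j<order w q. ext_deriv j (ev f) w = 0}"

lemma vanishing_space_const:
  assumes "c \<noteq> 0"
  shows "vanishing_space [:c:] = UNIV"
proof -
  have "order w [:c:] = 0" for w
    using assms by (intro order_0I) simp
  then show ?thesis
    by (auto simp: vanishing_space_def)
qed

end

text \<open>Fixing the type, which is unique, determines which boundary derivatives are available.\<close>

locale typed_admissible_space = admissible_space ev
  for ev :: "'b::complex_banach \<Rightarrow> complex \<Rightarrow> complex" +
  fixes n :: nat
  assumes type_n: "boundary_extension_type ev n"
begin

lemma obtain_smooth_on:
  assumes "w \<in> \<D> \<or> w \<in> sphere 0 1 \<and> j < n"
  obtains S where "smooth_on j S" "w \<in> S"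
proof (cases "w \<in> \<D>")
  case True
  then show ?thesis using smooth_on_disk that by blast
next
  case False
  then have w: "w \<in> cball 0 1" and "j < n" using assms by auto
  then have "smooth_on (n - 1) (cball 0 1)"
    using smooth_on_cball type_n by simp
  then have "smooth_on j (cball 0 1)"
    using \<open>j < n\<close> by (auto simp: smooth_on_def smooth_upto_def)
  then show ?thesis using w that by blast
qed

lemma obtain_smooth_on_order:
  assumes "zeros_specifiable n q" "j < order w q"
  obtains S where "smooth_on j S" "w \<in> S"
proof -
  have "order w q \<noteq> 0" using assms(2) by simp
  then have "poly q w = 0" using order_root by blast
  then have "w \<in> \<D> \<or> w \<in> sphere 0 1 \<and> j < n"
    using assms by (auto simp: zeros_specifiable_def)
  then show ?thesis using obtain_smooth_on that by blast
qed

lemma root_in_cball: "zeros_specifiable n q \<Longrightarrow> poly q w = 0 \<Longrightarrow> w \<in> cball 0 1"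
  by (auto simp: zeros_specifiable_def)

lemma vanishing_space_add_scaleC:
  assumes "zeros_specifiable n q" "f \<in> vanishing_space q" "g \<in> vanishing_space q"
  shows "f + c *\<^sub>C g \<in> vanishing_space q"
  unfolding vanishing_space_def
proof (intro CollectI allI impI)
  fix w j assume j: "j < order w q"
  obtain S where "smooth_on j S" "w \<in> S"
    using obtain_smooth_on_order[OF assms(1) j] .
  then show "ext_deriv j (ev (f + c *\<^sub>C g)) w = 0"
    using assms(2,3) j by (simp add: ext_deriv_add ext_deriv_scaleC vanishing_space_def)
qed

text \<open>By the Leibniz rule the \<open>j\<close>-th derivative of (z - w) g at \<open>u\<close>
  is \<open>u - w\<close> times that of \<open>g\<close> plus \<open>j\<close> times the one of
  order \<open>j - 1\<close>. At \<open>u = w\<close> this is a shift of the order by one; elsewhere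
  it is a triangular system with nonzero diagonal entry \<open>u - w\<close>.\<close>

lemma vanishing_space_mult_linear:
  assumes good: "zeros_specifiable n ([:- w, 1:] * q)"
  shows "mult_poly [:- w, 1:] g \<in> vanishing_space ([:- w, 1:] * q) \<longleftrightarrow> g \<in> vanishing_space q"
proof -
  define D where "D j u f = ext_deriv j (ev f) u" for j u f
  have "q \<noteq> 0" using good by (auto simp: zeros_specifiable_def)
  note ord = order_linear_mult[OF this, of _ w]
  have rec: "D j u (mult_poly [:- w, 1:] g) = (u - w) * D j u g + of_nat j * D (j - 1) u g"
    if j: "j < order u ([:- w, 1:] * q)" for j u
  proof -
    obtain S where S: "smooth_on j S" "u \<in> S"
      using obtain_smooth_on_order[OF good j] .
    have "mult_poly [:- w, 1:] g = mult_z g + (- w) *\<^sub>C g"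
      by (simp add: mult_poly_linear)
    then show ?thesis
      by (simp only: D_def ext_deriv_add[OF S] ext_deriv_scaleC[OF S] ext_deriv_mult_z[OF S])
        (simp add: algebra_simps)
  qed
  show ?thesis
  proof
    assume g: "g \<in> vanishing_space q"
    have "D j u (mult_poly [:- w, 1:] g) = 0" if j: "j < order u ([:- w, 1:] * q)" for j u
    proof (cases "u = w")
      case True
      then have "j = 0 \<or> j - 1 < order u q" using j ord by auto
      then show ?thesis using g True rec[OF j] by (auto simp: vanishing_space_def D_def)
    next
      case False
      then have "j < order u q" using j ord by simp
      then show ?thesis using g rec[OF j] by (simp add: vanishing_space_def D_def)
    qed
    then show "mult_poly [:- w, 1:] g \<in> vanishing_space ([:- w, 1:] * q)"
      unfolding vanishing_space_def D_def by blast
  next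
    assume g: "mult_poly [:- w, 1:] g \<in> vanishing_space ([:- w, 1:] * q)"
    have zero: "(u - w) * D j u g + of_nat j * D (j - 1) u g = 0"
      if "j < order u ([:- w, 1:] * q)" for j u
      using g rec[OF that] that by (simp add: vanishing_space_def D_def)
    \<comment> \<open>For \<open>u = w\<close> the relation of order \<open>j + 1\<close> reads
      \<open>(j + 1) * D j w g = 0\<close>. For other \<open>u\<close> the relation of order
      \<open>j\<close> suffices, its lower term vanishing by induction.\<close>
    have "D j u g = 0" if "j < order u q" for j u
      using that
    proof (induction j)
      case 0
      then show ?case using zero[of 0 u] zero[of 1 u] ord[of u] by (cases "u = w") auto
    next
      case (Suc j)
      then show ?case
        using zero[of "Suc j" u] zero[of "Suc (Suc j)" u] ord[of u] of_nat_neq_0[of "Suc j", where 'a = complex]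
        by (cases "u = w") (auto simp del: of_nat_Suc)
    qed
    then show "g \<in> vanishing_space q"
      unfolding vanishing_space_def D_def by blast
  qed
qed

lemma mult_poly_in_vanishing_space:
  assumes "zeros_specifiable n q"
  shows "mult_poly q f \<in> vanishing_space q"
proof -
  have "q \<noteq> 0" using assms by (simp add: zeros_specifiable_def)
  then show ?thesis using assms
  proof (induction q rule: complex_poly_factor_induct)
    case (linear w q)
    then show ?case
      using vanishing_space_mult_linear[OF linear.prems] zeros_specifiable_mult[OF linear.prems]
      unfolding mult_poly_mult by blast
  qed (simp add: vanishing_space_const)
qed

text \<open>For the converse, vanishing of order 0 at a root \<open>w\<close> of \<open>q\<close>
  splits \<open>z - w\<close> off \<open>p\<close>, and \<open>vanishing_space_mult_linear\<close>
  cancels this factor on both sides.\<close>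

lemma poly_elem_in_vanishing_space_iff:
  assumes "zeros_specifiable n q"
  shows "poly_elem p \<in> vanishing_space q \<longleftrightarrow> q dvd p"
proof
  assume "q dvd p"
  then obtain r where "p = q * r" by (elim dvdE)
  then show "poly_elem p \<in> vanishing_space q"
    using mult_poly_in_vanishing_space[OF assms, of "poly_elem r"] by (simp add: mult_poly_poly_elem)
next
  have "q \<noteq> 0" using assms by (simp add: zeros_specifiable_def)
  then show "poly_elem p \<in> vanishing_space q \<Longrightarrow> q dvd p" using assms
  proof (induction q arbitrary: p rule: complex_poly_factor_induct)
    case (const c)
    then show ?case by (simp add: is_unit_pCons_iff unit_imp_dvd)
  next
    case (linear w q)
    have "w \<in> cball 0 1"
      using root_in_cball[OF linear.prems(2), of w] by simp
    moreover have "ext_deriv 0 (ev (poly_elem p)) w = 0"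
      using linear.prems(1) order_linear_mult[OF linear.hyps, of w w]
      by (auto simp: vanishing_space_def)
    ultimately have "poly p w = 0"
      by (simp add: ext_deriv_poly_elem)
    then obtain r where r: "p = [:- w, 1:] * r"
      by (auto simp: poly_eq_0_iff_dvd elim: dvdE)
    then have "poly_elem r \<in> vanishing_space q"
      using linear.prems(1) vanishing_space_mult_linear[OF linear.prems(2)]
      by (simp only: mult_poly_poly_elem[symmetric])
    then have "q dvd r"
      using linear.IH zeros_specifiable_mult[OF linear.prems(2)] by blast
    then show ?case
      unfolding r by (rule mult_dvd_mono[OF dvd_refl])
  qed
qed

text \<open>Passing from \<open>q\<close> to \<open>(z - w) q\<close> imposes one more functional, and this functional does not
  vanish at \<open>q\<close>, so \<open>q\<close> is the new direction of the complement.\<close>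

lemma projection_onto_vanishing_space:
  assumes "zeros_specifiable n q"
  shows "\<exists>R. bounded_linear R \<and> (\<forall>f. R f \<in> vanishing_space q) \<and>
    (\<forall>f\<in>vanishing_space q. R f = f) \<and>
    (\<forall>f. \<exists>p. f - R f = poly_elem p \<and> (p = 0 \<or> degree p < degree q))"
proof -
  have "q \<noteq> 0" using assms by (simp add: zeros_specifiable_def)
  then show ?thesis using assms
  proof (induction q rule: complex_poly_factor_induct)
    case (const c)
    show ?case
      by (rule exI[of _ "\<lambda>f. f"]) (use const in \<open>auto simp: vanishing_space_const poly_elem_0 intro: exI[of _ 0]\<close>)
  next
    case (linear w q)
    let ?q = "[:- w, 1:] * q" and ?e = "poly_elem q" and ?m = "order w q"
    \<comment> \<open>The conditions of \<open>q\<close> at \<open>w\<close> concern the orders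
      below \<open>?m\<close>; the additional factor adds exactly the order
      \<open>?m\<close>.\<close>
    define L where "L f = ext_deriv ?m (ev f) w" for f
    note good = linear.prems zeros_specifiable_mult[OF linear.prems]
    note ord = order_linear_mult[OF linear.hyps, of _ w]
    obtain S where S: "smooth_on ?m S" "w \<in> S"
      using obtain_smooth_on_order[OF good(1), of ?m w] ord[of w] by auto
    obtain R where R: "bounded_linear R" "\<And>f. R f \<in> vanishing_space q"
      "\<And>f. f \<in> vanishing_space q \<Longrightarrow> R f = f"
      "\<And>f. \<exists>p. f - R f = poly_elem p \<and> (p = 0 \<or> degree p < degree q)"
      using linear.IH[OF good(2)] by blast
    have L: "bounded_linear L"
      unfolding L_def by (rule bounded_linear_ext_deriv[OF S])
    have L_linear: "L (f + a *\<^sub>C g) = L f + a * L g" for f g a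
      by (simp only: L_def ext_deriv_add[OF S] ext_deriv_scaleC[OF S])
    have vanish_iff: "f \<in> vanishing_space ?q \<longleftrightarrow> f \<in> vanishing_space q \<and> L f = 0" for f
      unfolding vanishing_space_def L_def ord by (auto simp: less_Suc_eq)
    have deg: "degree ?q = Suc (degree q)"
      using linear.hyps by (subst degree_mult_eq) auto
    have e: "?e \<in> vanishing_space q"
      using poly_elem_in_vanishing_space_iff[OF good(2)] by simp
    \<comment> \<open>Otherwise \<open>?e\<close> would satisfy all conditions of \<open>?q\<close>,
      so that \<open>?q\<close> would divide \<open>q\<close>, a polynomial of smaller
      degree.\<close>
    have "L ?e \<noteq> 0"
    proof
      assume "L ?e = 0"
      then have "?q dvd q"
        using e vanish_iff poly_elem_in_vanishing_space_iff[OF good(1)] by blast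
      then show False
        using dvd_imp_degree_le[of ?q q] linear.hyps deg by simp
    qed
    \<comment> \<open>Chosen so that \<open>L\<close> annihilates
      \<open>R f - c f *\<^sub>C ?e\<close>. If \<open>f\<close> already satisfies all conditions,
      then \<open>R f = f\<close> and \<open>c f = 0\<close>, so \<open>f\<close> is left
      fixed.\<close>
    define c where "c f = L (R f) / L ?e" for f
    define R' where "R' f = R f - c f *\<^sub>C ?e" for f
    have "bounded_linear c"
      unfolding c_def
      by (intro bounded_linear_divide[THEN bounded_linear_compose] bounded_linear_compose[OF L] R(1))
    moreover have "bounded_linear (\<lambda>a. a *\<^sub>C ?e)"
    proof (rule bounded_linear_intro[where K = "norm ?e"])
      show "(r *\<^sub>R a) *\<^sub>C ?e = r *\<^sub>R a *\<^sub>C ?e" for r a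
        by (simp only: scaleR_conv_of_real scaleC_scaleC[symmetric] scaleC_of_real)
    qed (simp_all add: scaleC_add_left norm_scaleC)
    ultimately have "bounded_linear R'"
      unfolding R'_def by (intro bounded_linear_sub R(1)) (rule bounded_linear_compose)
    moreover have "R' f \<in> vanishing_space ?q" for f
    proof -
      have eq: "R' f = R f + (- c f) *\<^sub>C ?e" by (simp add: R'_def)
      have "L (R' f) = 0"
        unfolding eq L_linear using \<open>L ?e \<noteq> 0\<close> by (simp add: c_def)
      then show ?thesis
        unfolding vanish_iff using vanishing_space_add_scaleC[OF good(2) R(2) e, of f "- c f"] eq by simp
    qed
    moreover have "R' f = f" if "f \<in> vanishing_space ?q" for f
      using that[unfolded vanish_iff] R(3)[of f] by (simp add: R'_def c_def)
    moreover have "\<exists>p. f - R' f = poly_elem p \<and> (p = 0 \<or> degree p < degree ?q)" for f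
    proof -
      obtain p where p: "f - R f = poly_elem p" "p = 0 \<or> degree p < degree q"
        using R(4) by blast
      have "f - R' f = poly_elem (p + smult (c f) q)"
        using p(1) by (simp add: R'_def poly_elem_add poly_elem_smult)
      moreover have "degree (p + smult (c f) q) \<le> degree q"
        using p(2) by (intro degree_add_le) auto
      ultimately show ?thesis
        unfolding deg by (metis le_imp_less_Suc)
    qed
    ultimately show ?case by blast
  qed
qed

text \<open>The range of a projection is its set of fixed points, which is closed because the
  projection is continuous.\<close>

lemma closed_vanishing_space:
  assumes "zeros_specifiable n q"
  shows "closed (vanishing_space q)"
proof -
  obtain R where R: "bounded_linear R" "\<And>f. R f \<in> vanishing_space q"
      "\<And>f. f \<in> vanishing_space q \<Longrightarrow> R f = f"
    using projection_onto_vanishing_space[OF assms] by blast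
  have "vanishing_space q = {f. R f = f}"
    using R(2,3) by (metis (mono_tags, lifting) Collect_cong Collect_mem_eq)
  moreover have "closed {f. R f = f}"
    by (intro closed_Collect_eq linear_continuous_on R(1) continuous_on_id)
  ultimately show ?thesis by simp
qed

lemma vanishing_space_eq_closure:
  assumes "zeros_specifiable n q"
  shows "vanishing_space q = closure (range (mult_poly q))"
proof
  show "closure (range (mult_poly q)) \<subseteq> vanishing_space q"
    using closed_vanishing_space[OF assms] mult_poly_in_vanishing_space[OF assms]
    by (intro closure_minimal) auto
  show "vanishing_space q \<subseteq> closure (range (mult_poly q))"
  proof
    fix f assume f: "f \<in> vanishing_space q"
    obtain R where R: "bounded_linear R" "\<And>f. R f \<in> vanishing_space q"
      "\<And>f. f \<in> vanishing_space q \<Longrightarrow> R f = f"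
      "\<And>f. \<exists>p. f - R f = poly_elem p"
      using projection_onto_vanishing_space[OF assms] by blast
    obtain p where "(\<lambda>k. poly_elem (p k)) \<longlonglongrightarrow> f"
      by (rule poly_elem_approx)
    then have "(\<lambda>k. R (poly_elem (p k))) \<longlonglongrightarrow> f"
      using bounded_linear.tendsto[OF R(1)] R(3)[OF f] by metis
    moreover have "R (poly_elem (p k)) \<in> range (mult_poly q)" for k
    proof -
      \<comment> \<open>\<open>R\<close> changes each element by a polynomial, so it maps
        polynomials to polynomials.\<close>
      obtain r where "poly_elem (p k) - R (poly_elem (p k)) = poly_elem r"
        using R(4) by blast
      then have eq: "R (poly_elem (p k)) = poly_elem (p k - r)"
        by (simp add: poly_elem_diff algebra_simps)
      then have "q dvd p k - r"
        using R(2) poly_elem_in_vanishing_space_iff[OF assms] by metis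
      then obtain s where "p k - r = q * s" by (elim dvdE)
      then show ?thesis
        using eq mult_poly_poly_elem[of q s] by (metis rangeI)
    qed
    ultimately show "f \<in> closure (range (mult_poly q))"
      unfolding closure_sequential by (intro exI[of _ "\<lambda>k. R (poly_elem (p k))"]) simp
  qed
qed

text \<open>At a zero \<open>w\<close> in the open disk the quotient by \<open>z - w\<close> is
  holomorphic, and \<open>division\<close> returns it to the space. Factors can thus be removed
  exactly, without passing to a closure.\<close>

lemma vanishing_space_eq_range:
  assumes "q \<noteq> 0" "{z. poly q z = 0} \<subseteq> \<D>"
  shows "vanishing_space q = range (mult_poly q)"
proof -
  have "zeros_specifiable n q"
    using assms by (auto simp: zeros_specifiable_def)
  moreover have "vanishing_space q \<subseteq> range (mult_poly q)"
    using assms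
  proof (induction q rule: complex_poly_factor_induct)
    case (const c)
    have "f = mult_poly [:c:] ((1 / c) *\<^sub>C f)" for f
      using const by (intro ev_inject) (simp add: ev_simps)
    then show ?case by blast
  next
    case (linear w q)
    have w: "w \<in> \<D>" using linear.prems by auto
    have good: "zeros_specifiable n ([:- w, 1:] * q)"
      using linear.prems linear_mult_neq_0[OF linear.hyps, of w] unfolding zeros_specifiable_def by blast
    show ?case
    proof
      fix f assume f: "f \<in> vanishing_space ([:- w, 1:] * q)"
      then have "ext_deriv 0 (ev f) w = 0"
        using order_linear_mult[OF linear.hyps, of w w] by (auto simp: vanishing_space_def)
      then have ev_w: "ev f w = 0"
        using w by (simp add: ext_deriv_interior)
      \<comment> \<open>The quotient of \<open>f\<close> by \<open>z - w\<close>, with the removable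
        singularity filled in by the derivative.\<close>
      define \<phi> where "\<phi> z = (if z = w then deriv (ev f) w else (ev f z - ev f w) / (z - w))" for z
      have "\<phi> holomorphic_on \<D>"
        unfolding \<phi>_def by (rule pole_lemma_open[OF ev_holomorphic open_ball])
      moreover have "represents ev f (\<lambda>z. poly [:- w, 1:] z * \<phi> z)"
        by (auto simp: represents_def \<phi>_def ev_w)
      moreover have "{z. poly [:- w, 1:] z = 0} \<subseteq> \<D>"
        using w by auto
      ultimately obtain g where g: "represents ev g \<phi>"
        using division by blast
      have f_eq: "f = mult_poly [:- w, 1:] g"
        using g by (intro ev_inject) (auto simp: represents_def ev_simps \<phi>_def ev_w)
      then have "g \<in> vanishing_space q"
        using f vanishing_space_mult_linear[OF good] by blast
      then obtain h where "g = mult_poly q h"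
        using linear by auto
      then show "f \<in> range (mult_poly ([:- w, 1:] * q))"
        using f_eq by (simp only: mult_poly_mult[symmetric]) simp
    qed
  qed
  ultimately show ?thesis
    using mult_poly_in_vanishing_space by auto
qed

text \<open>The monomials of degree less than \<open>deg q\<close> form a basis of the quotient: a
  combination of them divisible by \<open>q\<close> is 0 for reasons of degree, and the projection
  leaves a remainder in their span.\<close>

lemma quotient_has_dim_vanishing_space:
  assumes "zeros_specifiable n q"
  shows "quotient_has_dim (vanishing_space q) (degree q)"
proof -
  define e where "e i = poly_elem (monom 1 i)" for i
  have inj: "inj e"
    by (intro injI) (simp add: e_def poly_elem_inject monom_eq_iff')
  have "q \<noteq> 0" using assms by (simp add: zeros_specifiable_def)
  have sum_e: "(\<Sum>x\<in>e ` {..<degree q}. c x *\<^sub>C x) = poly_elem (\<Sum>i<degree q. monom (c (e i)) i)" for c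
  proof -
    have "(\<Sum>x\<in>e ` {..<degree q}. c x *\<^sub>C x) = (\<Sum>i<degree q. c (e i) *\<^sub>C e i)"
      using inj_on_subset[OF inj] by (simp add: sum.reindex)
    also have "\<dots> = (\<Sum>i<degree q. poly_elem (monom (c (e i)) i))"
      by (simp add: e_def poly_elem_smult[symmetric] smult_monom)
    finally show ?thesis by (simp add: poly_elem_sum)
  qed
  have "c x = 0" if "(\<Sum>x\<in>e ` {..<degree q}. c x *\<^sub>C x) \<in> vanishing_space q" "x \<in> e ` {..<degree q}" for c x
  proof -
    define r where "r = (\<Sum>i<degree q. monom (c (e i)) i)"
    have coeff: "coeff r i = (if i < degree q then c (e i) else 0)" for i
      by (simp add: r_def coeff_sum if_distrib cong: if_cong)
    have "q dvd r"
      using that(1) poly_elem_in_vanishing_space_iff[OF assms] by (simp add: sum_e r_def)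
    moreover have "r = 0 \<or> degree r < degree q"
      by (metis coeff leading_coeff_0_iff)
    ultimately have "r = 0"
      using dvd_imp_degree_le[of q r] leD by blast
    then show ?thesis
      using that(2) coeff by (auto split: if_splits) (metis coeff_0)
  qed
  moreover have "\<exists>c. f - (\<Sum>x\<in>e ` {..<degree q}. c x *\<^sub>C x) \<in> vanishing_space q" for f
  proof -
    obtain R p where R: "R f \<in> vanishing_space q" "f - R f = poly_elem p" "p = 0 \<or> degree p < degree q"
      using projection_onto_vanishing_space[OF assms] by metis
    \<comment> \<open>Coefficients are indexed by the basis elements themselves, so
      \<open>inv e\<close> is used to recover the exponent.\<close>
    have "(\<Sum>x\<in>e ` {..<degree q}. coeff p (inv e x) *\<^sub>C x) = poly_elem p"
    proof -
      have "(\<Sum>i<degree q. monom (coeff p i) i) = p"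
        using R(3) by (intro poly_eqI) (auto simp: coeff_sum if_distrib coeff_eq_0 cong: if_cong)
      then show ?thesis
        using inj by (simp add: sum_e)
    qed
    then have "f - (\<Sum>x\<in>e ` {..<degree q}. coeff p (inv e x) *\<^sub>C x) = R f"
      using R(2) by (simp add: algebra_simps)
    then show ?thesis using R(1) by metis
  qed
  moreover have "card (e ` {..<degree q}) = degree q"
    using inj_on_subset[OF inj] by (simp add: card_image)
  ultimately show ?thesis
    unfolding quotient_has_dim_def by (intro exI[of _ "e ` {..<degree q}"]) blast
qed

text \<open>Under type \<open>n > m\<close> the closure of the multiples of (z - 1)^(m+1) contains
  only those polynomials that (z - 1)^(m+1) divides, whereas type \<open>m\<close> would put (z -
  1)^m into it. The point 1 stands for any boundary point.\<close>

lemma not_type_less: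
  assumes "m < n"
  shows "\<not> boundary_extension_type ev m"
proof
  assume type_m: "boundary_extension_type ev m"
  define q :: "complex poly" where "q = [:- 1, 1:] ^ (m + 1)"
  have "order 1 q = m + 1"
    unfolding q_def by (rule order_power_n_n)
  moreover have "poly q w = (w - 1) ^ (m + 1)" for w
    by (simp add: q_def poly_power del: power_Suc)
  moreover have "q \<noteq> 0"
    unfolding q_def by (rule power_not_zero) simp
  ultimately have good: "zeros_specifiable n q"
    using assms by (auto simp: zeros_specifiable_def)
  have "(\<lambda>z. (z - 1) ^ (m + 1)) = poly q"
    by (rule ext) (simp add: q_def poly_power del: power_Suc)
  then obtain h where h: "h \<in> closure (range (mult_poly q))" "represents ev h (\<lambda>z. (z - 1) ^ m)"
    using type_m unfolding boundary_extension_type_def by (auto dest!: bspec[of _ _ 1])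
  have "h = poly_elem ([:- 1, 1:] ^ m)"
    using h(2) by (intro ev_inject) (simp add: represents_def poly_power)
  then have "q dvd [:- 1, 1:] ^ m"
    using h(1) vanishing_space_eq_closure[OF good] poly_elem_in_vanishing_space_iff[OF good] by simp
  then show False
    unfolding q_def order_divides using order_power_n_n[of "1 :: complex" m] by simp
qed

lemma type_unique: "boundary_extension_type ev m \<Longrightarrow> m = n"
proof (rule ccontr)
  assume m: "boundary_extension_type ev m" "m \<noteq> n"
  \<comment> \<open>With the roles of \<open>m\<close> and \<open>n\<close> exchanged,
    \<open>not_type_less\<close> also excludes \<open>n < m\<close>.\<close>
  interpret other: typed_admissible_space ev m
    by unfold_locales (rule m)
  show False
    using m type_n not_type_less other.not_type_less by (meson linorder_neqE_nat)
qed

section \<open>Zero-specification sets and polynomials\<close>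

text \<open>The definition allows any type of the space; uniqueness reduces this to
  \<open>n\<close>. For \<open>n = 0\<close> the conditions \<open>m > 0\<close> and
  \<open>m \<le> n\<close> together exclude boundary points.\<close>

lemma finite_zero_specification_iff:
  "finite_zero_specification ev Z \<longleftrightarrow>
     finite Z \<and> inj_on fst Z \<and> (\<forall>(w, m)\<in>Z. m > 0 \<and> (w \<in> \<D> \<or> w \<in> sphere 0 1 \<and> m \<le> n))"
  (is "?lhs \<longleftrightarrow> ?rhs")
proof
  assume ?lhs
  then show ?rhs
    using type_unique unfolding finite_zero_specification_def by fast
next
  assume rhs: ?rhs
  show ?lhs
  proof (cases "n = 0")
    case True
    then have "boundary_extension_type ev 0" "\<forall>(w, m)\<in>Z. w \<in> \<D>"
      using type_n rhs by auto
    then show ?thesis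
      using rhs unfolding finite_zero_specification_def by fast
  next
    case False
    then show ?thesis
      unfolding finite_zero_specification_def
      using rhs type_n by (intro conjI disjI2 exI[of _ n]) auto
  qed
qed

lemma zero_subspace_eq_vanishing_space:
  assumes Z: "finite_zero_specification ev Z" and q: "prescribes_zeros Z q"
  shows "zeros_specifiable n q" "zero_subspace ev Z = vanishing_space q"
proof -
  have root: "(w, order w q) \<in> Z" if "poly q w = 0" for w
    using that q by (fastforce simp: prescribes_zeros_def)
  then show "zeros_specifiable n q"
    using Z q unfolding zeros_specifiable_def finite_zero_specification_iff prescribes_zeros_def by fast
  have "\<forall>(w, m)\<in>Z. m = order w q"
    using q by (auto simp: prescribes_zeros_def)
  moreover have "(w, order w q) \<in> Z" if "j < order w q" for j w
    using that root[of w] order_root[of q w] by auto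
  ultimately show "zero_subspace ev Z = vanishing_space q"
    unfolding zero_subspace_def vanishing_space_def
    by (intro Collect_cong iffI allI impI) (blast, auto)
qed

lemma obtain_zero_specification:
  assumes "zeros_specifiable n q"
  obtains Z where "finite_zero_specification ev Z" "prescribes_zeros Z q"
proof
  let ?Z = "(\<lambda>w. (w, order w q)) ` {w. poly q w = 0}"
  have "q \<noteq> 0" using assms by (simp add: zeros_specifiable_def)
  then show "prescribes_zeros ?Z q"
    by (force simp: prescribes_zeros_def)
  have "order w q > 0" if "poly q w = 0" for w
    using that \<open>q \<noteq> 0\<close> by (simp add: order_root)
  then show "finite_zero_specification ev ?Z"
    using assms \<open>q \<noteq> 0\<close> poly_roots_finite[of q]
    by (auto simp: finite_zero_specification_iff zeros_specifiable_def inj_on_def)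
qed

text \<open>For a polynomial the derivative of order \<open>m - 1\<close> is always differentiable,
  so the last clause of \<open>zero_of_mult\<close> just says that the \<open>m\<close>-th
  derivative is nonzero.\<close>

lemma zero_of_mult_poly_elem:
  assumes "w \<in> cball 0 1" "q \<noteq> 0" "m > 0"
  shows "zero_of_mult (ev (poly_elem q)) w m \<longleftrightarrow> order w q = m"
proof -
  have "(ext_deriv (m - 1) (ev (poly_elem q)) has_field_derivative 0) (at w within cball 0 1) \<longleftrightarrow>
      (poly ((pderiv ^^ (m - 1)) q) has_field_derivative 0) (at w within cball 0 1)"
    by (rule has_field_derivative_cong_openin[OF openin_subtopology_self assms(1) ext_deriv_poly_elem])
  also have "\<dots> \<longleftrightarrow> poly ((pderiv ^^ m) q) w = 0"
  proof -
    have "(poly ((pderiv ^^ (m - 1)) q) has_field_derivative poly (pderiv ((pderiv ^^ (m - 1)) q)) w)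
        (at w within cball 0 1)"
      by (rule has_field_derivative_at_within[OF poly_DERIV])
    moreover have "pderiv ((pderiv ^^ (m - 1)) q) = (pderiv ^^ m) q"
      using \<open>m > 0\<close> by (cases m) auto
    ultimately show ?thesis
      using has_field_derivative_unique[OF _ _ at_within_cball_neq_bot[OF assms(1)]] by metis
  qed
  finally have "zero_of_mult (ev (poly_elem q)) w m \<longleftrightarrow>
      (\<forall>j<m. poly ((pderiv ^^ j) q) w = 0) \<and> \<not> (\<forall>j<Suc m. poly ((pderiv ^^ j) q) w = 0)"
    unfolding zero_of_mult_def ext_deriv_poly_elem[OF assms(1)] by (auto simp: less_Suc_eq)
  then show ?thesis
    unfolding pderiv_funpow_zero_iff_order[OF assms(2)] by auto
qed

lemma specifies_poly_zeros_iff: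
  assumes Z: "finite_zero_specification ev Z"
  shows "specifies_poly_zeros ev Z q \<longleftrightarrow> prescribes_zeros Z q"
proof (cases "q = 0")
  case True
  \<comment> \<open>The zero polynomial satisfies neither side, because its zeros fill the plane and
    \<open>Z\<close> is finite.\<close>
  have "finite (fst ` Z)"
    using Z by (simp add: finite_zero_specification_def)
  then show ?thesis
    using True infinite_UNIV_char_0[where 'a = complex] finite_subset[of UNIV "fst ` Z"]
    by (auto simp: specifies_poly_zeros_def prescribes_zeros_def)
next
  case False
  have "zero_of_mult (ev (poly_elem q)) w m \<longleftrightarrow> order w q = m" if "(w, m) \<in> Z" for w m
    using Z that False by (intro zero_of_mult_poly_elem) (force simp: finite_zero_specification_iff)+
  moreover have "extend (ev (poly_elem q)) \<zeta> = poly q \<zeta>" if "\<zeta> \<in> sphere 0 1" for \<zeta>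
    using ext_deriv_poly_elem[of \<zeta> 0 q] that by (simp add: ext_deriv_def)
  ultimately show ?thesis
    using False unfolding specifies_poly_zeros_def specifies_zeros_def prescribes_zeros_def by fastforce
qed

section \<open>Invariant subspaces\<close>

lemma mult_z_in_vanishing_space:
  assumes "zeros_specifiable n q" "f \<in> vanishing_space q"
  shows "mult_z f \<in> vanishing_space q"
  unfolding vanishing_space_def
proof (intro CollectI allI impI)
  fix w j assume j: "j < order w q"
  obtain S where S: "smooth_on j S" "w \<in> S"
    using obtain_smooth_on_order[OF assms(1) j] .
  show "ext_deriv j (ev (mult_z f)) w = 0"
    using assms(2) j by (simp add: ext_deriv_mult_z[OF S] vanishing_space_def)
qed

text \<open>Modulo the subspace, the \<open>card E + 1\<close> monomials of degree at most
  \<open>card E\<close> lie in the span of \<open>E\<close>, so they satisfy a nontrivial linear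
  relation.\<close>

lemma finite_codimensional_contains_poly:
  assumes N: "complex_vector.subspace N" "finite_codimensional N"
  obtains p where "p \<noteq> 0" "poly_elem p \<in> N"
proof -
  obtain E where E: "finite E" "\<And>f. \<exists>c. f - (\<Sum>e\<in>E. c e *\<^sub>C e) \<in> N"
    using N(2) unfolding finite_codimensional_def quotient_has_dim_def by blast
  define x where "x i = poly_elem (monom 1 i)" for i
  have "\<exists>c. \<forall>i. x i - (\<Sum>e\<in>E. c i e *\<^sub>C e) \<in> N"
    by (rule choice) (intro allI E(2))
  then obtain c where c: "\<And>i. x i - (\<Sum>e\<in>E. c i e *\<^sub>C e) \<in> N"
    by blast
  define y where "y i = (\<Sum>e\<in>E. c i e *\<^sub>C e)" for i
  define I where "I = {..card E}"
  have rel: "\<exists>p. p \<noteq> 0 \<and> poly_elem p \<in> N"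
    if "(\<Sum>i\<in>I. a i *\<^sub>C y i) = 0" "k \<in> I" "a k \<noteq> 0" for a k
  proof (intro exI conjI)
    define p where "p = (\<Sum>i\<in>I. monom (a i) i)"
    have "coeff p k = a k"
      using that(2) by (simp add: p_def coeff_sum I_def if_distrib cong: if_cong)
    then show "p \<noteq> 0" using that(3) by auto
    have "poly_elem p = (\<Sum>i\<in>I. a i *\<^sub>C (x i - y i)) + (\<Sum>i\<in>I. a i *\<^sub>C y i)"
    proof -
      have "poly_elem p = (\<Sum>i\<in>I. a i *\<^sub>C x i)"
        unfolding p_def x_def poly_elem_sum poly_elem_smult[symmetric] smult_monom by simp
      then show ?thesis
        by (simp only: sum.distrib[symmetric] scaleC_add_right[symmetric] diff_add_cancel)
    qed
    also have "\<dots> \<in> N"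
      unfolding that(1) add_0_right unfolding y_def
      by (rule complex_vector.subspace_sum[OF N(1) complex_vector.subspace_scale[OF N(1) c]])
    finally show "poly_elem p \<in> N" .
  qed
  have "\<exists>p. p \<noteq> 0 \<and> poly_elem p \<in> N"
  \<comment> \<open>Linear dependence is a notion for sets and does not register repetitions in the
    family \<open>y\<close>; a coincidence \<open>y i = y j\<close> is a relation by itself.\<close>
  proof (cases "inj_on y I")
    case False
    then obtain i j where ij: "i \<in> I" "j \<in> I" "i \<noteq> j" "y i = y j"
      unfolding inj_on_def by blast
    define a where "a k = (if k = i then 1 else if k = j then - 1 else 0 :: complex)" for k
    have "(\<Sum>k\<in>I. a k *\<^sub>C y k) = (\<Sum>k\<in>{i, j}. a k *\<^sub>C y k)"
      using ij by (intro sum.mono_neutral_right) (auto simp: I_def a_def)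
    also have "\<dots> = 0"
      using ij by (simp add: a_def)
    finally show ?thesis
      using rel[of a i] ij by (simp add: a_def)
  next
    case True
    have "y ` I \<subseteq> complex_vector.span E"
      unfolding y_def
      by (rule image_subsetI,
          rule complex_vector.span_sum[OF complex_vector.span_scale[OF complex_vector.span_base]])
    moreover have "card (y ` I) = Suc (card E)"
      using True by (simp add: card_image I_def)
    ultimately have "complex_vector.dependent (y ` I)"
      using complex_vector.independent_span_bound[OF E(1), of "y ` I"] by auto
    moreover have "finite (y ` I)" by (simp add: I_def)
    ultimately obtain u v where uv: "(\<Sum>v\<in>y ` I. u v *\<^sub>C v) = 0" "v \<in> y ` I" "u v \<noteq> 0"
      using complex_vector.dependent_finite by blast
    then obtain k where "k \<in> I" "v = y k" by auto
    moreover have "(\<Sum>i\<in>I. u (y i) *\<^sub>C y i) = 0"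
      using uv(1) True by (simp add: sum.reindex)
    ultimately show ?thesis
      using rel[of "\<lambda>i. u (y i)" k] uv(3) by simp
  qed
  then show ?thesis using that by blast
qed

text \<open>Invariance puts the polynomial multiples of \<open>q\<close> into the subspace; density
  of polynomials, continuity of \<open>mult_poly q\<close> and closedness yield all other
  multiples.\<close>

lemma mult_poly_in_invariant_subspace:
  assumes N: "complex_vector.subspace N" "closed N" "\<forall>f\<in>N. mult_z f \<in> N"
    and q: "poly_elem q \<in> N"
  shows "mult_poly q g \<in> N"
proof -
  have poly: "mult_poly p f \<in> N" if "f \<in> N" for p f
  proof (induction p)
    case 0
    show ?case
      unfolding mult_poly_0 using N(1) by (rule complex_vector.subspace_0)
  next
    case (pCons a p)
    then show ?case
      unfolding mult_poly_pCons
      using N that by (blast intro: complex_vector.subspace_add complex_vector.subspace_scale)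
  qed
  obtain p where "(\<lambda>k. poly_elem (p k)) \<longlonglongrightarrow> g"
    by (rule poly_elem_approx)
  then have lim: "(\<lambda>k. mult_poly q (poly_elem (p k))) \<longlonglongrightarrow> mult_poly q g"
    by (rule bounded_linear.tendsto[OF bounded_linear_mult_poly])
  have "mult_poly q (poly_elem (p k)) \<in> N" for k
    using poly[OF q, of "p k"] by (simp add: mult_poly_poly_elem mult.commute)
  then show ?thesis
    by (rule closed_sequentially[OF N(2) _ lim])
qed

text \<open>The polynomials in the subspace are the multiples of one polynomial \<open>q\<close> of minimal degree.
  By minimality \<open>q\<close> has no zero outside the closed disk, where \<open>z - w\<close> is invertible, and by the
  boundary-extension type no boundary zero of order more than \<open>n\<close>.\<close>

lemma invariant_subspace_eq_vanishing_space:
  assumes N: "complex_vector.subspace N" "closed N" "finite_codimensional N"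
    and inv: "\<forall>f\<in>N. mult_z f \<in> N"
  obtains q where "zeros_specifiable n q" "N = vanishing_space q"
proof -
  obtain p where "p \<noteq> 0 \<and> poly_elem p \<in> N"
    using finite_codimensional_contains_poly[OF N(1,3)] by blast
  from ex_has_least_nat[of "\<lambda>p. p \<noteq> 0 \<and> poly_elem p \<in> N", OF this, of degree]
  obtain q where q: "q \<noteq> 0" "poly_elem q \<in> N"
    and minimal: "\<And>p. p \<noteq> 0 \<Longrightarrow> poly_elem p \<in> N \<Longrightarrow> degree q \<le> degree p"
    by auto
  note ideal = mult_poly_in_invariant_subspace[OF N(1,2) inv q(2)]
  have good: "zeros_specifiable n q"
    unfolding zeros_specifiable_def
  proof (intro conjI allI impI q(1), rule ccontr)
    fix w assume w: "poly q w = 0" and bad: "\<not> (w \<in> \<D> \<or> w \<in> sphere 0 1 \<and> order w q \<le> n)"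
    then have "cmod w > 1 \<or> cmod w = 1 \<and> order w q > n"
      by auto
    then consider "cmod w > 1" | "cmod w = 1" "order w q > n"
      by blast
    then show False
    proof cases
      case 1
      obtain r where r: "q = [:- w, 1:] * r"
        using w by (auto simp: poly_eq_0_iff_dvd elim: dvdE)
      then have "r \<noteq> 0" using q(1) by auto
      then have deg: "degree q = Suc (degree r)"
        unfolding r by (subst degree_mult_eq) auto
      have "multiplier ev (poly [:- w, 1:])"
        unfolding multiplier_def represents_def using ev_mult_poly
        by (intro conjI allI holomorphic_intros) blast
      moreover have "cmod w - 1 \<le> cmod (poly [:- w, 1:] z)" if "z \<in> \<D>" for z
        using that norm_triangle_ineq2[of w z] by (simp add: norm_minus_commute)
      ultimately have "multiplier ev (\<lambda>z. 1 / poly [:- w, 1:] z)"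
        using 1 by (intro multiplier_inverse) (auto intro!: exI[of _ "cmod w - 1"] simp del: poly_pCons)
      then obtain h where h: "represents ev h (\<lambda>z. 1 / poly [:- w, 1:] z * ev (poly_elem 1) z)"
        unfolding multiplier_def by blast
      \<comment> \<open>The multiplier applied to the constant 1 gives \<open>h\<close> = 1 / (z -
        w), and multiplying \<open>q\<close> by it cancels the factor.\<close>
      have "mult_poly q h = poly_elem r"
        using h 1 by (intro ev_inject) (auto simp: r represents_def ev_simps simp del: mult_pCons_left)
      then have "poly_elem r \<in> N"
        using ideal[of h] by simp
      then show False
        using minimal[OF \<open>r \<noteq> 0\<close>] deg by simp
    next
      case 2
      define l where "l = [:- w, 1:]"
      have "l ^ (n + 1) dvd q"
        using 2 q(1) unfolding l_def order_divides by simp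
      then obtain r where r: "q = l ^ (n + 1) * r" by (elim dvdE)
      then have "r \<noteq> 0" using q(1) by auto
      have "l \<noteq> 0" "degree l = 1" by (simp_all add: l_def)
      then have "l ^ n * r \<noteq> 0" "degree (l ^ n * r) < degree q"
        unfolding r using \<open>r \<noteq> 0\<close> by (simp_all add: degree_mult_eq degree_power_eq del: power_Suc)
      moreover have "poly_elem (l ^ n * r) \<in> N"
      proof -
        have poly_l: "(\<lambda>z. (z - w) ^ k) = poly (l ^ k)" for k
          by (rule ext) (simp add: l_def poly_power)
        have "\<exists>g\<in>closure (range (mult_op ev (\<lambda>z. (z - w) ^ (n + 1)))). represents ev g (\<lambda>z. (z - w) ^ n)"
          using type_n 2(1) unfolding boundary_extension_type_def by (simp del: power_Suc)
        then obtain g where g: "g \<in> closure (range (mult_poly (l ^ (n + 1))))" "represents ev g (poly (l ^ n))"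
          unfolding poly_l by blast
        have "g = poly_elem (l ^ n)"
          using g(2) by (simp add: elem_eqI)
        with g(1) obtain s where s: "\<And>k. s k \<in> range (mult_poly (l ^ (n + 1)))" "s \<longlonglongrightarrow> poly_elem (l ^ n)"
          unfolding closure_sequential by blast
        \<comment> \<open>Multiplication by \<open>r\<close> maps multiples of
          \<open>l ^ (n + 1)\<close> to multiples of \<open>q\<close>, which lie in
          \<open>N\<close>. By continuity its value at the limit \<open>l ^ n\<close> lies in
          \<open>N\<close> as well.\<close>
        have "mult_poly r (s k) \<in> N" for k
        proof -
          obtain h where "s k = mult_poly (l ^ (n + 1)) h" using s(1) by blast
          then have "mult_poly r (s k) = mult_poly q h"
            unfolding r by (simp only: mult_poly_mult[symmetric] mult.commute)
          then show ?thesis using ideal by simp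
        qed
        moreover have lim: "(\<lambda>k. mult_poly r (s k)) \<longlonglongrightarrow> mult_poly r (poly_elem (l ^ n))"
          using s(2) by (rule bounded_linear.tendsto[OF bounded_linear_mult_poly])
        ultimately have "mult_poly r (poly_elem (l ^ n)) \<in> N"
          by (intro closed_sequentially[OF N(2) _ lim])
        then show ?thesis by (simp add: mult_poly_poly_elem mult.commute)
      qed
      ultimately show False
        using minimal leD by blast
    qed
  qed
  have sub: "vanishing_space q \<subseteq> N"
    unfolding vanishing_space_eq_closure[OF good] using ideal N(2) by (intro closure_minimal) auto
  obtain R where R: "\<And>f. R f \<in> vanishing_space q"
    "\<And>f. \<exists>p. f - R f = poly_elem p \<and> (p = 0 \<or> degree p < degree q)"
    using projection_onto_vanishing_space[OF good] by blast
  \<comment> \<open>Division with remainder: \<open>f - R f\<close> is a polynomial in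
    \<open>N\<close> of degree less than \<open>deg q\<close> or 0, so minimality forces it to be
    0.\<close>
  have "f \<in> vanishing_space q" if "f \<in> N" for f
  proof -
    obtain p where p: "f - R f = poly_elem p" "p = 0 \<or> degree p < degree q"
      using R(2) by blast
    have "poly_elem p \<in> N"
      unfolding p(1)[symmetric]
      by (rule complex_vector.subspace_diff[OF N(1) that]) (use sub R(1) in blast)
    then have "p = 0"
      using p(2) minimal leD by blast
    then have "f = R f"
      using p(1) by (simp add: poly_elem_0)
    then show ?thesis using R(1) by metis
  qed
  then show ?thesis using that good sub by blast
qed

lemma invariant_subspace_iff:
  assumes "complex_vector.subspace N" "closed N" "finite_codimensional N"
  shows "(\<forall>f\<in>N. mult_z f \<in> N) \<longleftrightarrow> (\<exists>Z. finite_zero_specification ev Z \<and> N = zero_subspace ev Z)"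
proof
  assume "\<forall>f\<in>N. mult_z f \<in> N"
  then obtain q where q: "zeros_specifiable n q" "N = vanishing_space q"
    using invariant_subspace_eq_vanishing_space assms by blast
  obtain Z where "finite_zero_specification ev Z" "prescribes_zeros Z q"
    using obtain_zero_specification[OF q(1)] .
  then show "\<exists>Z. finite_zero_specification ev Z \<and> N = zero_subspace ev Z"
    using q(2) zero_subspace_eq_vanishing_space by blast
next
  assume "\<exists>Z. finite_zero_specification ev Z \<and> N = zero_subspace ev Z"
  then obtain Z where Z: "finite_zero_specification ev Z" "N = zero_subspace ev Z" by blast
  then obtain q where "prescribes_zeros Z q"
    using prescribed_poly_exists unfolding finite_zero_specification_iff by blast
  then show "\<forall>f\<in>N. mult_z f \<in> N"
    using zero_subspace_eq_vanishing_space[OF Z(1)] mult_z_in_vanishing_space Z(2) by blast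
qed

lemma specifies_poly_zeros_exists:
  assumes "finite_zero_specification ev Z"
  shows "\<exists>q. specifies_poly_zeros ev Z q"
  using assms prescribed_poly_exists[of Z] specifies_poly_zeros_iff[OF assms]
  unfolding finite_zero_specification_def by blast

lemma zero_subspace_eq_closure:
  assumes Z: "finite_zero_specification ev Z" and q: "specifies_poly_zeros ev Z q"
  shows "zero_subspace ev Z = closure (range (mult_poly q))"
    and "quotient_has_dim (zero_subspace ev Z) (degree q)"
  using zero_subspace_eq_vanishing_space[OF Z q[unfolded specifies_poly_zeros_iff[OF Z]]]
    vanishing_space_eq_closure quotient_has_dim_vanishing_space by auto

lemma zero_subspace_eq_range:
  assumes Z: "finite_zero_specification ev Z" and q: "specifies_poly_zeros ev Z q"
    and "fst ` Z \<inter> sphere 0 1 = {}"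
  shows "zero_subspace ev Z = range (mult_poly q)"
proof -
  have q': "prescribes_zeros Z q"
    using q specifies_poly_zeros_iff[OF Z] by simp
  have "fst ` Z \<subseteq> \<D>"
  proof
    fix w assume w: "w \<in> fst ` Z"
    then have "w \<in> \<D> \<or> w \<in> sphere 0 1"
      using Z unfolding finite_zero_specification_iff by fastforce
    then show "w \<in> \<D>" using w assms(3) by blast
  qed
  then show ?thesis
    using q' zero_subspace_eq_vanishing_space[OF Z q'] vanishing_space_eq_range[of q]
    by (auto simp: prescribes_zeros_def)
qed

lemma no_boundary_points_if_type_0:
  assumes "finite_zero_specification ev Z" "boundary_extension_type ev 0"
  shows "fst ` Z \<inter> sphere 0 1 = {}"
  using assms type_unique[OF assms(2)] by (force simp: finite_zero_specification_iff)

end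

theorem theorem3p10:
  fixes ev :: "'b::complex_banach \<Rightarrow> complex \<Rightarrow> complex"
  assumes "admissible_space ev"
  shows
    "(\<forall>N. complex_vector.subspace N \<and> closed N \<and> finite_codimensional N \<longrightarrow>
         ((\<forall>f\<in>N. mult_op ev (\<lambda>z. z) f \<in> N) \<longleftrightarrow>
          (\<exists>Z. finite_zero_specification ev Z \<and> N = zero_subspace ev Z))) \<and>
     (\<forall>Z. finite_zero_specification ev Z \<and>
           (boundary_extension_type ev 0 \<or>
            positive_boundary_extension_type ev \<and> fst ` Z \<inter> sphere 0 1 = {}) \<longrightarrow>
         (\<exists>q. specifies_poly_zeros ev Z q \<and>
              zero_subspace ev Z = range (mult_op ev (poly q)) \<and>
              quotient_has_dim (zero_subspace ev Z) (degree q))) \<and>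
     (\<forall>Z. finite_zero_specification ev Z \<and>
           positive_boundary_extension_type ev \<and> fst ` Z \<inter> sphere 0 1 \<noteq> {} \<longrightarrow>
         (\<exists>q. specifies_poly_zeros ev Z q) \<and>
         (\<forall>q. specifies_poly_zeros ev Z q \<longrightarrow>
              zero_subspace ev Z = closure (range (mult_op ev (poly q))) \<and>
              quotient_has_dim (zero_subspace ev Z) (degree q)))"
proof -
  interpret admissible_space ev by fact
  obtain n where n: "boundary_extension_type ev n"
    using has_boundary_extension_type by blast
  interpret typed_admissible_space ev n
    by unfold_locales (rule n)
  show ?thesis
  proof (intro conjI allI impI)
    fix N :: "'b set"
    assume "complex_vector.subspace N \<and> closed N \<and> finite_codimensional N"
    then show "(\<forall>f\<in>N. mult_z f \<in> N) \<longleftrightarrow> (\<exists>Z. finite_zero_specification ev Z \<and> N = zero_subspace ev Z)"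
      by (intro invariant_subspace_iff) auto
  next
    fix Z
    assume "finite_zero_specification ev Z \<and> (boundary_extension_type ev 0 \<or>
      positive_boundary_extension_type ev \<and> fst ` Z \<inter> sphere 0 1 = {})"
    \<comment> \<open>Type 0 admits no specified boundary points, so both alternatives of the first
      situation come down to their absence.\<close>
    then have Z: "finite_zero_specification ev Z" and "fst ` Z \<inter> sphere 0 1 = {}"
      using no_boundary_points_if_type_0 by blast+
    moreover obtain q where "specifies_poly_zeros ev Z q"
      using specifies_poly_zeros_exists[OF Z] by blast
    ultimately show "\<exists>q. specifies_poly_zeros ev Z q \<and> zero_subspace ev Z = range (mult_poly q) \<and>
        quotient_has_dim (zero_subspace ev Z) (degree q)"
      using zero_subspace_eq_range zero_subspace_eq_closure(2) by blast
  qed (use specifies_poly_zeros_exists zero_subspace_eq_closure in blast)+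
qed

end
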